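(* Let $\alpha\ge 1/2$, $\lambda>0$, and let $X$ be a positive random variable with $E[X^{\alpha+4}]<\infty$. Then for every $r>0$, $$\frac{d}{dr}I(X;X_r)\le \lambda\Big(E[X]-E\Big[E\big[\sqrt X\,\mathcal V_r(X)\,\big|\,X_r\big]^2\Big]\Big),$$ where $X_r$ and $\mathcal V_r(X)$ are the output and ratio of the quadratic gamma channel defined in the context.
   Context: For $a,b>0$, $\gamma(a,b)$ denotes (a random variable with) the gamma distribution with density $\frac{b^{a}}{\Gamma(a)}x^{a-1}e^{-bx}$ on $(0,\infty)$; $\gamma(0,b)$ is understood as the constant $0$. Quadratic gamma channel: with $X$, $\gamma(\alpha-\tfrac12,\lambda)$ and a standard Gaussian $N$ mutually independent, $$Y_r=\sqrt{rX}+\frac{N}{\sqrt{2\lambda}},\qquad X_r=\gamma(\alpha-\tfrac12,\lambda)+Y_r^2,\qquad \mathcal V_r(X)=\frac{Y_r}{\sqrt{X_r}}.$$ Mutual information: $I(X;Y)=E\big[\log\frac{dP^{X,Y}}{d(P^X\otimes P^Y)}(X,Y)\big]$, where $P^{X,Y}$ is the joint law of $(X,Y)$ and $P^X,P^Y$ are its marginals. *)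

theory Defs
  imports "HOL-Probability.Probability"
begin

definition gamma_density :: "real \<Rightarrow> real \<Rightarrow> real \<Rightarrow> real" where
  "gamma_density a b x =
     (if x \<le> 0 then 0 else b powr a / Gamma a * x powr (a - 1) * exp (- b * x))"

definition gamma_distribution :: "real \<Rightarrow> real \<Rightarrow> real measure" where
  "gamma_distribution a b =
     (if a = 0 then return borel 0 else density lborel (\<lambda>x. ennreal (gamma_density a b x)))"

text \<open>
  The quadratic gamma channel: \<open>X\<close> is the input, \<open>N\<close> the standard Gaussian noise and
  \<open>G\<close> the gamma noise with law \<open>gamma_distribution (\<alpha> - 1/2) lam\<close>.
\<close>

definition channel_Y ::
  "real \<Rightarrow> ('a \<Rightarrow> real) \<Rightarrow> ('a \<Rightarrow> real) \<Rightarrow> real \<Rightarrow> 'a \<Rightarrow> real" where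
  "channel_Y lam X N r \<omega> = sqrt (r * X \<omega>) + N \<omega> / sqrt (2 * lam)"

definition channel_output ::
  "real \<Rightarrow> ('a \<Rightarrow> real) \<Rightarrow> ('a \<Rightarrow> real) \<Rightarrow> ('a \<Rightarrow> real) \<Rightarrow> real \<Rightarrow> 'a \<Rightarrow> real" where
  "channel_output lam X G N r \<omega> = G \<omega> + (channel_Y lam X N r \<omega>)\<^sup>2"

text \<open>The output is almost surely positive, so division by zero affects only a null set.\<close>

definition channel_ratio ::
  "real \<Rightarrow> ('a \<Rightarrow> real) \<Rightarrow> ('a \<Rightarrow> real) \<Rightarrow> ('a \<Rightarrow> real) \<Rightarrow> real \<Rightarrow> 'a \<Rightarrow> real" where
  "channel_ratio lam X G N r \<omega> = channel_Y lam X N r \<omega> / sqrt (channel_output lam X G N r \<omega>)"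

end

theory Submission
  imports Defs
begin

text \<open>
  Write \<open>Z\<close> for the output, \<open>Y\<close> for the shifted Gaussian, \<open>V = Y / sqrt Z\<close> and \<open>R = sqrt Z\<close>.  For the
  input \<open>0\<close> the ratio \<open>V\<close> and the output \<open>Z\<close> are independent, with laws \<open>\<pi>\<close> on \<open>[-1,1]\<close> and \<open>\<nu>\<close>
  (\<open>polar_decomposition\<close>): this is the rotational symmetry of the noise.  Shifting the Gaussian
  by \<open>sqrt (s x)\<close> multiplies this reference law by
  \<open>exp (lam (2 sqrt (s x) v R - s x))\<close>, so \<open>(X, V, Z)\<close> has that density with respect to
  \<open>\<mu> \<otimes> \<pi> \<otimes> \<nu>\<close> (\<open>channel_joint_law\<close>).  Bessel functions and the noncentral chi-squared density are
  thereby hidden in the integral over \<open>\<pi>\<close>.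

  Let \<open>k\<close> (\<open>likelihood\<close>) be the integral of the density over \<open>v\<close>, and \<open>m\<close> (\<open>prior.partition\<close>) its
  integral over \<open>v\<close> and \<open>x\<close>.  Then \<open>I(X;Z) = E[ln k - ln m]\<close>, evaluated at \<open>(X, R)\<close>.  The derivative in \<open>s\<close> is computed
  along the trajectories: with \<open>X\<close>, \<open>G\<close> and \<open>N\<close> fixed, \<open>R\<close> is a function of \<open>s\<close> with derivative
  \<open>sqrt X V / (2 sqrt s)\<close>.  Both \<open>k\<close> and \<open>m\<close> are partition functions, so the derivatives of their
  logarithms are posterior means.  With \<open>W = E[sqrt X V | X, Z]\<close> and \<open>w = E[sqrt X V | Z]\<close> the
  derivative of the information density is
  \<open>lam ((R / sqrt r + sqrt X V) (W - w) - (X - E[X | Z]))\<close>.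
  Taking expectations, the tower property kills every term except
  \<open>lam (E[sqrt X V W] - E[w\<^sup>2])\<close>, and \<open>\<bar>V\<bar> \<le> 1\<close>, \<open>\<bar>W\<bar> \<le> sqrt X\<close> give the bound
  (\<open>info_deriv_le\<close>).

  Differentiating under the expectation needs an integrable Lipschitz constant
  (\<open>info_lipschitz\<close>).  The tilting exponent is Lipschitz in \<open>s\<close> along a trajectory, even where \<open>R\<close>
  vanishes; by Jensen's inequality (\<open>ln_integral_exp_diff_le\<close>) the Lipschitz constant of \<open>ln m\<close> is a
  posterior mean of that of the exponent; and the posterior mean of the input is at most affine in
  the output (\<open>posterior_mean_bound\<close>), because an input much larger than the output is
  exponentially unlikely.
\<close>

section \<open>Differentiation under the integral sign\<close>

text \<open>
  A Lipschitz bound at the single point \<open>r\<close> replaces the usual bound on derivatives near \<open>r\<close>: for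
  \<open>\<alpha> = 1/2\<close> the trajectories of the channel fail to be differentiable where the output vanishes,
  and for every \<open>s\<close> near \<open>r\<close> that may happen on some trajectory.
\<close>

lemma
  fixes f :: "real \<Rightarrow> 'a \<Rightarrow> real"
  assumes e: "0 < e"
    and int: "\<And>s. \<bar>s - r\<bar> < e \<Longrightarrow> integrable M (f s)"
    and D: "integrable M D"
    and f'[measurable]: "f' \<in> borel_measurable M"
    and deriv: "AE \<omega> in M. ((\<lambda>s. f s \<omega>) has_real_derivative f' \<omega>) (at r)"
    and lip: "\<And>s. \<bar>s - r\<bar> < e \<Longrightarrow> AE \<omega> in M. \<bar>f s \<omega> - f r \<omega>\<bar> \<le> \<bar>s - r\<bar> * D \<omega>"
  shows integrable_derivative_lipschitz: "integrable M f'"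
    and has_real_derivative_integral_lipschitz:
      "((\<lambda>s. \<integral>\<omega>. f s \<omega> \<partial>M) has_real_derivative (\<integral>\<omega>. f' \<omega> \<partial>M)) (at r)"
proof -
  have seq: "integrable M f' \<and>
      (\<lambda>n. ((\<integral>\<omega>. f (Y n) \<omega> \<partial>M) - (\<integral>\<omega>. f r \<omega> \<partial>M)) / (Y n - r)) \<longlonglongrightarrow> (\<integral>\<omega>. f' \<omega> \<partial>M)"
    if Y: "\<And>n. \<bar>Y n - r\<bar> < e" "\<And>n. Y n \<noteq> r" "Y \<longlonglongrightarrow> r" for Y :: "nat \<Rightarrow> real"
  proof -
    let ?s = "\<lambda>n \<omega>. (f (Y n) \<omega> - f r \<omega>) / (Y n - r)"
    have fm[measurable]: "f (Y n) \<in> borel_measurable M" "f r \<in> borel_measurable M" for n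
      using int[OF Y(1)[of n]] int[of r] e by auto
    have lim: "AE \<omega> in M. (\<lambda>n. ?s n \<omega>) \<longlonglongrightarrow> f' \<omega>"
      using deriv
    proof eventually_elim
      case (elim \<omega>)
      then have "((\<lambda>s. (f s \<omega> - f r \<omega>) / (s - r)) \<longlongrightarrow> f' \<omega>) (at r)"
        by (simp add: has_field_derivative_iff)
      then show ?case
        using Y(2,3) by (auto simp: tendsto_at_iff_sequentially comp_def)
    qed
    have bnd: "AE \<omega> in M. norm (?s n \<omega>) \<le> D \<omega>" for n
      using lip[OF Y(1)[of n]]
    proof eventually_elim
      case (elim \<omega>)
      have "\<bar>Y n - r\<bar> > 0" using Y(2)[of n] by auto
      with elim show ?case by (simp add: abs_divide field_simps)
    qed
    have 1: "integrable M f'"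
      by (rule integrable_dominated_convergence[where s="?s" and w=D])
         (use D lim bnd in auto)
    have 2: "(\<lambda>n. \<integral>\<omega>. ?s n \<omega> \<partial>M) \<longlonglongrightarrow> (\<integral>\<omega>. f' \<omega> \<partial>M)"
      by (rule integral_dominated_convergence[where w=D])
         (use D lim bnd in auto)
    have eq: "(\<integral>\<omega>. ?s n \<omega> \<partial>M) = ((\<integral>\<omega>. f (Y n) \<omega> \<partial>M) - (\<integral>\<omega>. f r \<omega> \<partial>M)) / (Y n - r)" for n
      by (subst Bochner_Integration.integral_diff[symmetric]) (use int[OF Y(1)[of n]] int[of r] e in auto)
    show ?thesis using 1 2 unfolding eq by blast
  qed
  have "(\<lambda>n. r + e * (1 / (real n + 2))) \<longlonglongrightarrow> r + e * 0"
    by (intro tendsto_intros) real_asymp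
  then have lim: "(\<lambda>n. r + e * (1 / (real n + 2))) \<longlonglongrightarrow> r" by simp
  have "\<bar>(r + e * (1 / (real n + 2))) - r\<bar> < e" "r + e * (1 / (real n + 2)) \<noteq> r" for n
    using e by (auto simp: field_simps intro: add_pos_nonneg)
  then show "integrable M f'"
    using seq[OF _ _ lim] by blast
  show "((\<lambda>s. \<integral>\<omega>. f s \<omega> \<partial>M) has_real_derivative (\<integral>\<omega>. f' \<omega> \<partial>M)) (at r)"
    unfolding has_field_derivative_iff tendsto_at_iff_sequentially comp_def
  proof (intro allI impI)
    fix Y :: "nat \<Rightarrow> real"
    assume Y: "\<forall>i. Y i \<in> UNIV - {r}" "Y \<longlonglongrightarrow> r"
    from Y(2) e obtain k where k: "\<And>n. n \<ge> k \<Longrightarrow> \<bar>Y n - r\<bar> < e"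
      by (metis LIMSEQ_iff real_norm_def)
    show "(\<lambda>n. ((\<integral>\<omega>. f (Y n) \<omega> \<partial>M) - (\<integral>\<omega>. f r \<omega> \<partial>M)) / (Y n - r)) \<longlonglongrightarrow> (\<integral>\<omega>. f' \<omega> \<partial>M)"
      by (rule LIMSEQ_offset[where k=k])
         (use seq[of "\<lambda>n. Y (n + k)"] k Y LIMSEQ_ignore_initial_segment[OF Y(2)] in auto)
  qed
qed

text \<open>
  Jensen's inequality for the probability measure proportional to \<open>exp E1\<close>, under which \<open>\<beta>\<close> bounds
  the mean of \<open>b\<close>.  The tangent of the exponential at \<open>\<beta>\<close> proves it without normalising.
\<close>

lemma ln_integral_exp_diff_le:
  fixes E1 E2 b :: "'a \<Rightarrow> real" and \<delta> \<beta> :: real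
  assumes i1[simp]: "integrable M (\<lambda>t. exp (E1 t))" and i2: "integrable M (\<lambda>t. exp (E2 t))"
    and ib[simp]: "integrable M (\<lambda>t. b t * exp (E1 t))"
    and le: "AE t in M. E1 t - E2 t \<le> \<delta> * b t"
    and pos: "0 < (\<integral>t. exp (E1 t) \<partial>M)"
    and mean: "(\<integral>t. b t * exp (E1 t) \<partial>M) \<le> \<beta> * (\<integral>t. exp (E1 t) \<partial>M)"
    and "0 \<le> \<delta>"
  shows "ln (\<integral>t. exp (E1 t) \<partial>M) - ln (\<integral>t. exp (E2 t) \<partial>M) \<le> \<delta> * \<beta>"
proof -
  let ?m = "\<integral>t. exp (E1 t) \<partial>M" and ?B = "\<integral>t. b t * exp (E1 t) \<partial>M"
  have "exp (- (\<delta> * \<beta>)) * ?m \<le> exp (- (\<delta> * \<beta>)) * (?m + \<delta> * (\<beta> * ?m - ?B))"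
    using mult_nonneg_nonneg[of \<delta> "\<beta> * ?m - ?B"] mean \<open>0 \<le> \<delta>\<close> by (intro mult_left_mono) auto
  also have "\<dots> = (\<integral>t. exp (- (\<delta> * \<beta>)) * (exp (E1 t) + \<delta> * (\<beta> * exp (E1 t) - b t * exp (E1 t))) \<partial>M)"
    by simp
  also have "\<dots> \<le> (\<integral>t. exp (E2 t) \<partial>M)"
  proof (rule integral_mono_AE)
    show "AE t in M. exp (- (\<delta> * \<beta>)) * (exp (E1 t) + \<delta> * (\<beta> * exp (E1 t) - b t * exp (E1 t))) \<le> exp (E2 t)"
      using le
    proof eventually_elim
      case (elim t)
      have "exp (- (\<delta> * \<beta>)) * (exp (E1 t) + \<delta> * (\<beta> * exp (E1 t) - b t * exp (E1 t)))
          = exp (E1 t - \<delta> * \<beta>) * (1 + \<delta> * (\<beta> - b t))"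
        by (simp add: exp_diff exp_minus field_simps)
      also have "\<dots> \<le> exp (E1 t - \<delta> * \<beta>) * exp (\<delta> * (\<beta> - b t))"
        by (intro mult_left_mono) auto
      also have "\<dots> = exp (E1 t - \<delta> * b t)"
        by (simp add: exp_add[symmetric] algebra_simps)
      also have "\<dots> \<le> exp (E2 t)" using elim by simp
      finally show ?case .
    qed
  qed (use i2 in auto)
  finally have *: "exp (- (\<delta> * \<beta>)) * ?m \<le> (\<integral>t. exp (E2 t) \<partial>M)" .
  then have "ln (exp (- (\<delta> * \<beta>)) * ?m) \<le> ln (\<integral>t. exp (E2 t) \<partial>M)"
    using pos by (subst ln_le_cancel_iff) (auto intro: less_le_trans[OF _ *])
  then show ?thesis
    using pos by (simp add: ln_mult)
qed

section \<open>Posterior means\<close>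

text \<open>
  A parameter \<open>T\<close> and an observation \<open>S\<close> with joint density \<open>e\<close>; the law is given by nonnegative
  integrals, so that regrouping several variables into \<open>T\<close> and \<open>S\<close> is immediate.  The channel is
  viewed in this way with three different choices of \<open>T\<close> and \<open>S\<close>.
\<close>

locale joint_density = prob_space M + pair_sigma_finite \<kappa> \<nu>
  for M :: "'a measure" and \<kappa> :: "'t measure" and \<nu> :: "'s measure" +
  fixes T :: "'a \<Rightarrow> 't" and S :: "'a \<Rightarrow> 's" and e :: "'t \<times> 's \<Rightarrow> real"
  assumes T[measurable]: "T \<in> measurable M \<kappa>" and S[measurable]: "S \<in> measurable M \<nu>"
    and e[measurable]: "e \<in> borel_measurable (\<kappa> \<Otimes>\<^sub>M \<nu>)" and e_nonneg: "\<And>p. 0 \<le> e p"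
    and law: "\<And>h. h \<in> borel_measurable (\<kappa> \<Otimes>\<^sub>M \<nu>) \<Longrightarrow>
      (\<integral>\<^sup>+\<omega>. h (T \<omega>, S \<omega>) \<partial>M) = (\<integral>\<^sup>+s. \<integral>\<^sup>+t. h (t, s) * ennreal (e (t, s)) \<partial>\<kappa> \<partial>\<nu>)"
    and marginal_finite: "AE s in \<nu>. integrable \<kappa> (\<lambda>t. e (t, s))"
    and marginal_positive: "AE s in \<nu>. 0 < (\<integral>t. e (t, s) \<partial>\<kappa>)"
begin

definition marginal :: "'s \<Rightarrow> real" where
  "marginal s = (\<integral>t. e (t, s) \<partial>\<kappa>)"

definition posterior :: "('t \<times> 's \<Rightarrow> real) \<Rightarrow> 's \<Rightarrow> real" where
  "posterior q s = (\<integral>t. q (t, s) * e (t, s) \<partial>\<kappa>) / marginal s"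

lemma marginal_measurable[measurable]: "marginal \<in> borel_measurable \<nu>"
  unfolding marginal_def by measurable

lemma posterior_measurable[measurable]:
  assumes [measurable]: "q \<in> borel_measurable (\<kappa> \<Otimes>\<^sub>M \<nu>)"
  shows "posterior q \<in> borel_measurable \<nu>"
  unfolding posterior_def by measurable

lemma distr_joint: "distr M (\<kappa> \<Otimes>\<^sub>M \<nu>) (\<lambda>\<omega>. (T \<omega>, S \<omega>)) = density (\<kappa> \<Otimes>\<^sub>M \<nu>) (\<lambda>p. ennreal (e p))"
proof (rule measure_eqI)
  fix A assume "A \<in> sets (distr M (\<kappa> \<Otimes>\<^sub>M \<nu>) (\<lambda>\<omega>. (T \<omega>, S \<omega>)))"
  then have A[measurable]: "A \<in> sets (\<kappa> \<Otimes>\<^sub>M \<nu>)" by simp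
  have "emeasure (distr M (\<kappa> \<Otimes>\<^sub>M \<nu>) (\<lambda>\<omega>. (T \<omega>, S \<omega>))) A = (\<integral>\<^sup>+p. indicator A p \<partial>distr M (\<kappa> \<Otimes>\<^sub>M \<nu>) (\<lambda>\<omega>. (T \<omega>, S \<omega>)))"
    by simp
  also have "\<dots> = (\<integral>\<^sup>+\<omega>. indicator A (T \<omega>, S \<omega>) \<partial>M)"
    by (subst nn_integral_distr) auto
  also have "\<dots> = (\<integral>\<^sup>+s. \<integral>\<^sup>+t. indicator A (t, s) * ennreal (e (t, s)) \<partial>\<kappa> \<partial>\<nu>)"
    by (rule law) measurable
  also have "\<dots> = (\<integral>\<^sup>+p. indicator A p * ennreal (e p) \<partial>(\<kappa> \<Otimes>\<^sub>M \<nu>))"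
    by (rule nn_integral_snd) measurable
  also have "\<dots> = emeasure (density (\<kappa> \<Otimes>\<^sub>M \<nu>) (\<lambda>p. ennreal (e p))) A"
    by (subst emeasure_density) (auto simp: mult.commute)
  finally show "emeasure (distr M (\<kappa> \<Otimes>\<^sub>M \<nu>) (\<lambda>\<omega>. (T \<omega>, S \<omega>))) A =
    emeasure (density (\<kappa> \<Otimes>\<^sub>M \<nu>) (\<lambda>p. ennreal (e p))) A" .
qed simp

lemma distr_marginal: "distr M \<nu> S = density \<nu> (\<lambda>s. ennreal (marginal s))"
proof (rule measure_eqI)
  fix A assume "A \<in> sets (distr M \<nu> S)"
  then have A[measurable]: "A \<in> sets \<nu>" by simp
  have "emeasure (distr M \<nu> S) A = (\<integral>\<^sup>+p. indicator A p \<partial>distr M \<nu> S)"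
    by simp
  also have "\<dots> = (\<integral>\<^sup>+\<omega>. indicator A (S \<omega>) \<partial>M)"
    by (subst nn_integral_distr) auto
  also have "\<dots> = (\<integral>\<^sup>+\<omega>. (\<lambda>p. indicator A (snd p)) (T \<omega>, S \<omega>) \<partial>M)" by simp
  also have "\<dots> = (\<integral>\<^sup>+s. \<integral>\<^sup>+t. indicator A s * ennreal (e (t, s)) \<partial>\<kappa> \<partial>\<nu>)"
    by (subst law) auto
  also have "\<dots> = (\<integral>\<^sup>+s. ennreal (marginal s) * indicator A s \<partial>\<nu>)"
  proof (rule nn_integral_cong_AE)
    show "AE s in \<nu>. (\<integral>\<^sup>+t. indicator A s * ennreal (e (t, s)) \<partial>\<kappa>) = ennreal (marginal s) * indicator A s"
      using marginal_finite AE_space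
    proof eventually_elim
      case (elim s)
      then have "(\<integral>\<^sup>+t. ennreal (e (t, s)) \<partial>\<kappa>) = ennreal (marginal s)"
        unfolding marginal_def by (intro nn_integral_eq_integral) (auto simp: e_nonneg)
      with elim show ?case
        by (subst nn_integral_cmult) (auto simp: mult.commute)
    qed
  qed
  also have "\<dots> = emeasure (density \<nu> (\<lambda>s. ennreal (marginal s))) A"
    by (subst emeasure_density) auto
  finally show "emeasure (distr M \<nu> S) A = emeasure (density \<nu> (\<lambda>s. ennreal (marginal s))) A" .
qed simp

lemma AE_observation:
  assumes [measurable]: "Measurable.pred \<nu> P" and "AE s in \<nu>. P s"
  shows "AE \<omega> in M. P (S \<omega>)"
proof -
  have "AE s in distr M \<nu> S. P s"
    unfolding distr_marginal using assms(2) by (subst AE_density) auto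
  then show ?thesis by (subst (asm) AE_distr_iff) auto
qed

lemma marginal_nonneg: "0 \<le> marginal s"
  unfolding marginal_def by (simp add: e_nonneg)

lemma
  assumes q[measurable]: "q \<in> borel_measurable (\<kappa> \<Otimes>\<^sub>M \<nu>)"
    and int: "integrable M (\<lambda>\<omega>. q (T \<omega>, S \<omega>))"
  shows integrable_posterior: "integrable M (\<lambda>\<omega>. posterior q (S \<omega>))"
    and expectation_posterior: "expectation (\<lambda>\<omega>. posterior q (S \<omega>)) = expectation (\<lambda>\<omega>. q (T \<omega>, S \<omega>))"
proof -
  have "integrable (distr M (\<kappa> \<Otimes>\<^sub>M \<nu>) (\<lambda>\<omega>. (T \<omega>, S \<omega>))) q"
    using int by (subst integrable_distr_eq) auto
  then have qe: "integrable (\<kappa> \<Otimes>\<^sub>M \<nu>) (\<lambda>p. e p * q p)"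
    unfolding distr_joint by (subst (asm) integrable_real_density) (auto simp: e_nonneg)
  have "AE s in \<nu>. marginal s * posterior q s = (\<integral>t. e (t, s) * q (t, s) \<partial>\<kappa>)"
    using marginal_positive
    by eventually_elim (simp add: posterior_def marginal_def mult.commute)
  note eq = this
  have "integrable \<nu> (\<lambda>s. \<integral>t. e (t, s) * q (t, s) \<partial>\<kappa>)"
    using integrable_snd[of "\<lambda>t s. e (t, s) * q (t, s)"] qe by (simp add: case_prod_beta')
  then have "integrable \<nu> (\<lambda>s. marginal s * posterior q s)"
    by (subst integrable_cong_AE[OF _ _ eq]) auto
  then have "integrable (distr M \<nu> S) (posterior q)"
    unfolding distr_marginal by (subst integrable_real_density) (auto simp: marginal_nonneg)
  then show "integrable M (\<lambda>\<omega>. posterior q (S \<omega>))"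
    by (subst (asm) integrable_distr_eq) auto
  have "expectation (\<lambda>\<omega>. posterior q (S \<omega>)) = integral\<^sup>L (distr M \<nu> S) (posterior q)"
    by (subst integral_distr) auto
  also have "\<dots> = (\<integral>s. marginal s * posterior q s \<partial>\<nu>)"
    unfolding distr_marginal by (subst integral_real_density) (auto simp: marginal_nonneg)
  also have "\<dots> = (\<integral>s. \<integral>t. e (t, s) * q (t, s) \<partial>\<kappa> \<partial>\<nu>)"
    by (rule integral_cong_AE[OF _ _ eq]) auto
  also have "\<dots> = (\<integral>p. e p * q p \<partial>(\<kappa> \<Otimes>\<^sub>M \<nu>))"
    using integral_snd[of "\<lambda>t s. e (t, s) * q (t, s)"] qe by (simp add: case_prod_beta')
  also have "\<dots> = integral\<^sup>L (distr M (\<kappa> \<Otimes>\<^sub>M \<nu>) (\<lambda>\<omega>. (T \<omega>, S \<omega>))) q"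
    unfolding distr_joint by (subst integral_real_density) (auto simp: e_nonneg)
  also have "\<dots> = expectation (\<lambda>\<omega>. q (T \<omega>, S \<omega>))"
    by (subst integral_distr) auto
  finally show "expectation (\<lambda>\<omega>. posterior q (S \<omega>)) = expectation (\<lambda>\<omega>. q (T \<omega>, S \<omega>))" .
qed

lemma real_cond_exp_posterior:
  assumes q[measurable]: "q \<in> borel_measurable (\<kappa> \<Otimes>\<^sub>M \<nu>)"
    and int: "integrable M (\<lambda>\<omega>. q (T \<omega>, S \<omega>))"
  shows "AE \<omega> in M. real_cond_exp M (vimage_algebra (space M) S \<nu>) (\<lambda>\<omega>. q (T \<omega>, S \<omega>)) \<omega> = posterior q (S \<omega>)"
proof -
  let ?F = "vimage_algebra (space M) S \<nu>"
  have sub: "subalgebra M ?F"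
    unfolding subalgebra_def using measurable_iff_sets[of S M \<nu>] S by auto
  interpret F: finite_measure_subalgebra M ?F
    by unfold_locales (rule sub)
  show ?thesis
  proof (rule F.real_cond_exp_charact)
    show "(\<integral>\<omega>\<in>A. q (T \<omega>, S \<omega>) \<partial>M) = (\<integral>\<omega>\<in>A. posterior q (S \<omega>) \<partial>M)" if A: "A \<in> sets ?F" for A
    proof -
      obtain B where B[measurable]: "B \<in> sets \<nu>" and AB: "A = S -` B \<inter> space M"
        using A measurable_space[OF S] by (subst (asm) sets_vimage_algebra2) auto
      let ?q = "\<lambda>p. indicator B (snd p) * q p"
      have A': "A \<in> sets M" using sub A by (auto simp: subalgebra_def)
      have eq: "?q (T \<omega>, S \<omega>) = indicator A \<omega> * q (T \<omega>, S \<omega>)" if "\<omega> \<in> space M" for \<omega>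
        using that by (auto simp: AB indicator_def)
      have "integrable M (\<lambda>\<omega>. ?q (T \<omega>, S \<omega>))"
        using integrable_real_mult_indicator[OF A' int] eq
        by (subst Bochner_Integration.integrable_cong[OF refl eq]) (auto simp: mult.commute)
      then have "expectation (\<lambda>\<omega>. posterior ?q (S \<omega>)) = expectation (\<lambda>\<omega>. ?q (T \<omega>, S \<omega>))"
        by (intro expectation_posterior) auto
      moreover have "posterior ?q s = indicator B s * posterior q s" for s
        unfolding posterior_def by (auto simp: indicator_def)
      ultimately have "expectation (\<lambda>\<omega>. indicator B (S \<omega>) * posterior q (S \<omega>)) = expectation (\<lambda>\<omega>. indicator B (S \<omega>) * q (T \<omega>, S \<omega>))"
        by simp
      moreover have "indicator B (S \<omega>) = (indicator A \<omega> :: real)" if "\<omega> \<in> space M" for \<omega>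
        using that by (auto simp: AB indicator_def)
      ultimately show ?thesis
        unfolding set_lebesgue_integral_def by (simp cong: Bochner_Integration.integral_cong)
    qed
    show "integrable M (\<lambda>\<omega>. posterior q (S \<omega>))"
      by (rule integrable_posterior[OF q int])
    have "S \<in> measurable ?F \<nu>"
      by (intro measurable_vimage_algebra1 Pi_I measurable_space[OF S])
    then show "(\<lambda>\<omega>. posterior q (S \<omega>)) \<in> borel_measurable ?F"
      by measurable
  qed (rule int)
qed

text \<open>
  When the reference measure of \<open>T\<close> is its law, the joint law has density \<open>e / marginal\<close> with
  respect to the product of the laws of \<open>T\<close> and \<open>S\<close>.
\<close>

lemma mutual_information_eq_expectation:
  assumes \<kappa>: "distr M \<kappa> T = \<kappa>"
  shows "mutual_information (exp 1) \<kappa> \<nu> T S = expectation (\<lambda>\<omega>. ln (e (T \<omega>, S \<omega>) / marginal (S \<omega>)))"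
proof -
  let ?P = "\<kappa> \<Otimes>\<^sub>M density \<nu> (\<lambda>s. ennreal (marginal s))"
  let ?d = "\<lambda>p. e p / marginal (snd p)"
  have pd: "prob_space (density \<nu> (\<lambda>s. ennreal (marginal s)))"
    unfolding distr_marginal[symmetric] by (rule prob_space_distr) simp
  interpret S: prob_space "density \<nu> (\<lambda>s. ennreal (marginal s))" by (rule pd)
  interpret P: pair_sigma_finite \<kappa> "density \<nu> (\<lambda>s. ennreal (marginal s))" ..
  have d_eq: "density \<kappa> (\<lambda>_. 1) = \<kappa>" by (rule density_1)
  have "density \<kappa> (\<lambda>_. 1) \<Otimes>\<^sub>M density \<nu> (\<lambda>s. ennreal (marginal s))
      = density (\<kappa> \<Otimes>\<^sub>M \<nu>) (\<lambda>(t, s). 1 * ennreal (marginal s))"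
    by (rule pair_measure_density) (auto simp: M2.sigma_finite_measure_axioms S.sigma_finite_measure_axioms)
  then have P: "?P = density (\<kappa> \<Otimes>\<^sub>M \<nu>) (\<lambda>p. ennreal (marginal (snd p)))"
    unfolding d_eq by (simp add: case_prod_beta')
  have sets_P: "sets ?P = sets (\<kappa> \<Otimes>\<^sub>M \<nu>)" by (simp cong: sets_pair_measure_cong)
  have dm[measurable]: "?d \<in> borel_measurable (\<kappa> \<Otimes>\<^sub>M \<nu>)" by measurable
  have pos2: "AE p in \<kappa> \<Otimes>\<^sub>M \<nu>. 0 < marginal (snd p)"
  proof (rule AE_pair_measure)
    show "{x \<in> space (\<kappa> \<Otimes>\<^sub>M \<nu>). 0 < marginal (snd x)} \<in> sets (\<kappa> \<Otimes>\<^sub>M \<nu>)" by measurable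
    show "AE x in \<kappa>. AE y in \<nu>. 0 < marginal (snd (x, y))"
      using marginal_positive unfolding marginal_def by simp
  qed
  have "density ?P (\<lambda>p. ennreal (?d p)) = density (\<kappa> \<Otimes>\<^sub>M \<nu>) (\<lambda>p. ennreal (marginal (snd p)) * ennreal (?d p))"
    unfolding P by (rule density_density_eq) auto
  also have "\<dots> = density (\<kappa> \<Otimes>\<^sub>M \<nu>) (\<lambda>p. ennreal (e p))"
  proof (rule density_cong)
    show "AE p in \<kappa> \<Otimes>\<^sub>M \<nu>. ennreal (marginal (snd p)) * ennreal (?d p) = ennreal (e p)"
      using pos2 by eventually_elim (simp add: ennreal_mult'[symmetric])
  qed auto
  finally have joint: "distr M (\<kappa> \<Otimes>\<^sub>M \<nu>) (\<lambda>\<omega>. (T \<omega>, S \<omega>)) = density ?P (\<lambda>p. ennreal (?d p))"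
    unfolding distr_joint by simp
  have dmP: "?d \<in> borel_measurable ?P"
    by (subst measurable_cong_sets[OF sets_P refl]) (rule dm)
  have "mutual_information (exp 1) \<kappa> \<nu> T S = KL_divergence (exp 1) ?P (density ?P (\<lambda>p. ennreal (?d p)))"
    unfolding mutual_information_def \<kappa> distr_marginal joint ..
  also have "\<dots> = (\<integral>p. ?d p * log (exp 1) (?d p) \<partial>?P)"
    by (rule P.KL_density) (use dmP in \<open>auto simp: e_nonneg marginal_nonneg\<close>)
  also have "\<dots> = (\<integral>p. ln (?d p) \<partial>density ?P (\<lambda>p. ennreal (?d p)))"
    using dmP by (subst integral_real_density) (auto simp: e_nonneg marginal_nonneg log_def)
  also have "\<dots> = expectation (\<lambda>\<omega>. ln (e (T \<omega>, S \<omega>) / marginal (S \<omega>)))"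
    unfolding joint[symmetric] by (subst integral_distr) auto
  finally show ?thesis .
qed

end

section \<open>Polar decomposition of the noise\<close>

lemma normal_density_lam:
  assumes "0 < lam"
  shows "normal_density a (1 / sqrt (2 * lam)) y = sqrt (lam / pi) * exp (- lam * (y - a)\<^sup>2)"
  using assms by (simp add: normal_density_def power_divide real_sqrt_divide field_simps)

text \<open>
  Without gamma noise the ratio is the sign of the Gaussian, which by symmetry is independent of
  its square.
\<close>

lemma polar_decomposition_rademacher:
  assumes "0 < lam"
  shows "\<exists>\<pi> \<nu> :: real measure. prob_space \<pi> \<and> prob_space \<nu> \<and> sets \<pi> = sets borel \<and> sets \<nu> = sets borel \<and>
    (AE v in \<pi>. \<bar>v\<bar> \<le> 1) \<and> 0 < emeasure \<pi> {0..} \<and> (AE z in \<nu>. 0 < z) \<and>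
    (\<forall>h \<in> borel_measurable (borel \<Otimes>\<^sub>M borel).
      (\<integral>\<^sup>+y. h (y, y\<^sup>2) * ennreal (normal_density 0 (1 / sqrt (2 * lam)) y) \<partial>lborel) =
      (\<integral>\<^sup>+z. \<integral>\<^sup>+v. h (v * sqrt z, z) \<partial>\<pi> \<partial>\<nu>))"
proof (intro exI conjI ballI)
  let ?\<phi> = "normal_density 0 (1 / sqrt (2 * lam))"
  let ?sgn = "\<lambda>b. if b then 1 else - 1 :: real"
  let ?\<pi> = "distr (bernoulli_pmf (1/2)) borel ?sgn"
  let ?N = "density lborel (\<lambda>y. ennreal (?\<phi> y))"
  let ?\<nu> = "distr ?N borel (\<lambda>y. y\<^sup>2)"
  have N: "prob_space ?N"
    using assms by (intro prob_space_normal_density) simp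
  show "prob_space ?\<pi>" by (intro prob_space.prob_space_distr measure_pmf.prob_space_axioms) simp
  show "prob_space ?\<nu>" by (intro prob_space.prob_space_distr N) simp
  show "AE v in ?\<pi>. \<bar>v\<bar> \<le> 1" by (subst AE_distr_iff) auto
  have "emeasure ?\<pi> {0..} = (\<integral>\<^sup>+b. indicator {0..} (?sgn b) \<partial>bernoulli_pmf (1/2))"
    by (subst nn_integral_indicator[symmetric], simp, subst nn_integral_distr) auto
  also have "\<dots> > 0" by (simp add: ennreal_inverse_positive)
  finally show "0 < emeasure ?\<pi> {0..}" .
  show "AE z in ?\<nu>. 0 < z"
    using AE_lborel_singleton[of "0::real"]
    by (subst AE_distr_iff) (auto simp: AE_density)
  fix h :: "real \<times> real \<Rightarrow> ennreal" assume [measurable]: "h \<in> borel_measurable (borel \<Otimes>\<^sub>M borel)"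
  let ?A = "\<integral>\<^sup>+y. h (y, y\<^sup>2) * ennreal (?\<phi> y) \<partial>lborel"
  have refl: "(\<integral>\<^sup>+y. h (- y, y\<^sup>2) * ennreal (?\<phi> y) \<partial>lborel) = ?A"
    by (subst (2) nn_integral_real_affine[where c="-1" and t=0]) (auto simp: normal_density_def)
  have "(\<integral>\<^sup>+z. \<integral>\<^sup>+v. h (v * sqrt z, z) \<partial>?\<pi> \<partial>?\<nu>) =
      (\<integral>\<^sup>+z. h (sqrt z, z) * ennreal (1/2) + h (- sqrt z, z) * ennreal (1/2) \<partial>?\<nu>)"
    by (subst nn_integral_distr) auto
  also have "\<dots> = (\<integral>\<^sup>+y. (h (\<bar>y\<bar>, y\<^sup>2) * ennreal (1/2) + h (- \<bar>y\<bar>, y\<^sup>2) * ennreal (1/2)) * ennreal (?\<phi> y) \<partial>lborel)"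
    by (subst nn_integral_distr, simp, simp, subst nn_integral_density) (auto simp: mult.commute)
  also have "\<dots> = (\<integral>\<^sup>+y. ennreal (1/2) * (h (y, y\<^sup>2) * ennreal (?\<phi> y) + h (- y, y\<^sup>2) * ennreal (?\<phi> y)) \<partial>lborel)"
    by (intro nn_integral_cong) (auto simp: abs_if algebra_simps)
  also have "\<dots> = ennreal (1/2) * (?A + ?A)"
    by (subst nn_integral_cmult, simp, subst nn_integral_add) (auto simp: refl)
  also have "\<dots> = ?A"
  proof -
    have "ennreal (1/2) * 2 = ennreal (1/2) * ennreal 2" by simp
    also have "\<dots> = 1" by (subst ennreal_mult[symmetric]) auto
    finally show ?thesis by (simp add: mult_2[symmetric] mult.assoc[symmetric])
  qed
  finally show "?A = (\<integral>\<^sup>+z. \<integral>\<^sup>+v. h (v * sqrt z, z) \<partial>?\<pi> \<partial>?\<nu>)" ..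
qed simp_all

text \<open>
  The substitution \<open>z = g + y\<^sup>2\<close>, \<open>y = v sqrt z\<close> turns the joint density of the gamma and the Gaussian
  noise into a product: the exponentials combine to \<open>exp (- lam z)\<close>, and what is left of the gamma
  density is a power of \<open>z (1 - v\<^sup>2)\<close>.
\<close>

lemma polar_decomposition_gamma:
  assumes a: "0 < a" and lam: "0 < lam" and G: "prob_space (gamma_distribution a lam)"
  shows "\<exists>\<pi> \<nu> :: real measure. prob_space \<pi> \<and> prob_space \<nu> \<and> sets \<pi> = sets borel \<and> sets \<nu> = sets borel \<and>
    (AE v in \<pi>. \<bar>v\<bar> \<le> 1) \<and> 0 < emeasure \<pi> {0..} \<and> (AE z in \<nu>. 0 < z) \<and>
    (\<forall>h \<in> borel_measurable (borel \<Otimes>\<^sub>M borel).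
      (\<integral>\<^sup>+g. \<integral>\<^sup>+y. h (y, g + y\<^sup>2) * ennreal (normal_density 0 (1 / sqrt (2 * lam)) y) \<partial>lborel \<partial>gamma_distribution a lam) =
      (\<integral>\<^sup>+z. \<integral>\<^sup>+v. h (v * sqrt z, z) \<partial>\<pi> \<partial>\<nu>))"
proof -
  let ?\<phi> = "normal_density 0 (1 / sqrt (2 * lam))"
  let ?\<gamma> = "gamma_density a lam"
  define fa where "fa v = (if \<bar>v\<bar> < 1 then (1 - v\<^sup>2) powr (a - 1) else 0)" for v :: real
  define fb where "fb z = (if z \<le> 0 then 0 else lam powr a / Gamma a * sqrt (lam / pi) * z powr (a - 1/2) * exp (- lam * z))" for z :: real
  have [measurable]: "fa \<in> borel_measurable borel" "fb \<in> borel_measurable borel" "?\<gamma> \<in> borel_measurable borel"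
    unfolding fa_def fb_def gamma_density_def by measurable
  have nn: "0 \<le> fa v" "0 \<le> fb v" "0 \<le> ?\<gamma> v" for v
    using Gamma_real_pos[OF a] lam by (auto simp: fa_def fb_def gamma_density_def)
  have Gd: "gamma_distribution a lam = density lborel (\<lambda>x. ennreal (?\<gamma> x))"
    using a by (simp add: gamma_distribution_def)
  have jac: "sqrt z * (?\<phi> (v * sqrt z) * ?\<gamma> (z - (v * sqrt z)\<^sup>2)) = fa v * fb z" if z: "0 < z" for z v
  proof -
    have e: "z - (v * sqrt z)\<^sup>2 = z * (1 - v\<^sup>2)"
      using z by (simp add: power_mult_distrib algebra_simps)
    show ?thesis
    proof (cases "\<bar>v\<bar> < 1")
      case False
      then have "1 \<le> v\<^sup>2" by (simp add: abs_square_less_1[symmetric] linorder_not_less[symmetric])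
      then have "z * (1 - v\<^sup>2) \<le> 0" using z by (simp add: mult_le_0_iff)
      then show ?thesis using False by (simp add: e gamma_density_def fa_def)
    next
      case True
      then have v: "0 < 1 - v\<^sup>2" by (simp add: abs_square_less_1)
      then have zv: "0 < z * (1 - v\<^sup>2)" using z by simp
      then have \<gamma>: "?\<gamma> (z - (v * sqrt z)\<^sup>2) = lam powr a / Gamma a * (z powr (a - 1) * (1 - v\<^sup>2) powr (a - 1)) * exp (- lam * (z * (1 - v\<^sup>2)))"
        unfolding e gamma_density_def if_not_P[OF zv[folded not_le]] using z v by (simp add: powr_mult)
      have \<phi>: "?\<phi> (v * sqrt z) = sqrt (lam / pi) * exp (- lam * (z * v\<^sup>2))"
        unfolding normal_density_lam[OF lam] using z by (simp add: power_mult_distrib mult.commute)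
      have ex: "exp (- lam * (z * v\<^sup>2)) * exp (- lam * (z * (1 - v\<^sup>2))) = exp (- lam * z)"
        by (simp add: exp_add[symmetric] algebra_simps)
      have sq: "sqrt z * z powr (a - 1) = z powr (a - 1/2)"
        using z by (simp add: powr_half_sqrt[symmetric] powr_add[symmetric])
      have "sqrt z * (?\<phi> (v * sqrt z) * ?\<gamma> (z - (v * sqrt z)\<^sup>2)) =
          (1 - v\<^sup>2) powr (a - 1) * (lam powr a / Gamma a * sqrt (lam / pi) * (sqrt z * z powr (a - 1)) *
            (exp (- lam * (z * v\<^sup>2)) * exp (- lam * (z * (1 - v\<^sup>2)))))"
        unfolding \<gamma> \<phi> by (simp only: mult_ac)
      also have "\<dots> = fa v * fb z"
        unfolding sq ex fa_def fb_def using True z by simp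
      finally show ?thesis .
    qed
  qed
  \<comment> \<open>the two factors, up to normalisation, are the densities of a beta-type and a gamma law\<close>
  let ?A = "density lborel (\<lambda>v. ennreal (fa v))" and ?B = "density lborel (\<lambda>z. ennreal (fb z))"
  have polar: "(\<integral>\<^sup>+g. \<integral>\<^sup>+y. h (y, g + y\<^sup>2) * ennreal (?\<phi> y) \<partial>lborel \<partial>gamma_distribution a lam) =
      (\<integral>\<^sup>+z. \<integral>\<^sup>+v. h (v * sqrt z, z) \<partial>?A \<partial>?B)"
    if h[measurable]: "h \<in> borel_measurable (borel \<Otimes>\<^sub>M borel)" for h
  proof -
    let ?w = "\<lambda>y z. h (y, z) * (ennreal (?\<phi> y) * ennreal (?\<gamma> (z - y\<^sup>2)))"
    have "(\<integral>\<^sup>+g. \<integral>\<^sup>+y. h (y, g + y\<^sup>2) * ennreal (?\<phi> y) \<partial>lborel \<partial>gamma_distribution a lam) =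
        (\<integral>\<^sup>+g. ennreal (?\<gamma> g) * (\<integral>\<^sup>+y. h (y, g + y\<^sup>2) * ennreal (?\<phi> y) \<partial>lborel) \<partial>lborel)"
      unfolding Gd by (subst nn_integral_density) auto
    also have "\<dots> = (\<integral>\<^sup>+g. \<integral>\<^sup>+y. h (y, g + y\<^sup>2) * (ennreal (?\<phi> y) * ennreal (?\<gamma> g)) \<partial>lborel \<partial>lborel)"
      by (subst nn_integral_cmult[symmetric]) (auto simp: mult_ac)
    also have "\<dots> = (\<integral>\<^sup>+y. \<integral>\<^sup>+g. h (y, g + y\<^sup>2) * (ennreal (?\<phi> y) * ennreal (?\<gamma> g)) \<partial>lborel \<partial>lborel)"
      by (rule lborel_pair.Fubini') measurable
    also have "\<dots> = (\<integral>\<^sup>+y. \<integral>\<^sup>+z. ?w y z \<partial>lborel \<partial>lborel)"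
    proof (rule nn_integral_cong)
      fix y :: real
      show "(\<integral>\<^sup>+g. h (y, g + y\<^sup>2) * (ennreal (?\<phi> y) * ennreal (?\<gamma> g)) \<partial>lborel) = (\<integral>\<^sup>+z. ?w y z \<partial>lborel)"
        by (subst nn_integral_real_affine[where c=1 and t="- y\<^sup>2"]) auto
    qed
    also have "\<dots> = (\<integral>\<^sup>+z. \<integral>\<^sup>+y. ?w y z \<partial>lborel \<partial>lborel)"
      by (rule lborel_pair.Fubini'[symmetric]) measurable
    also have "\<dots> = (\<integral>\<^sup>+z. \<integral>\<^sup>+v. ennreal (fb z) * (ennreal (fa v) * h (v * sqrt z, z)) \<partial>lborel \<partial>lborel)"
    proof (rule nn_integral_cong)
      fix z :: real
      show "(\<integral>\<^sup>+y. ?w y z \<partial>lborel) = (\<integral>\<^sup>+v. ennreal (fb z) * (ennreal (fa v) * h (v * sqrt z, z)) \<partial>lborel)"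
      proof (cases "0 < z")
        case False
        then have "z - y\<^sup>2 \<le> 0" for y using zero_le_power2[of y] by linarith
        with False show ?thesis by (simp add: gamma_density_def fb_def)
      next
        case True
        have "(\<integral>\<^sup>+y. ?w y z \<partial>lborel) = (\<integral>\<^sup>+v. ennreal (sqrt z) * ?w (0 + sqrt z * v) z \<partial>lborel)"
          using True by (subst nn_integral_real_affine[where c="sqrt z" and t=0]) (auto simp: nn_integral_cmult)
        also have "\<dots> = (\<integral>\<^sup>+v. ennreal (fb z) * (ennreal (fa v) * h (v * sqrt z, z)) \<partial>lborel)"
        proof (rule nn_integral_cong)
          fix v
          have *: "ennreal (sqrt z) * (ennreal (?\<phi> (v * sqrt z)) * ennreal (?\<gamma> (z - (v * sqrt z)\<^sup>2))) = ennreal (fb z) * ennreal (fa v)"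
            using jac[OF True, of v] True by (simp add: ennreal_mult'[symmetric] nn mult.commute)
          have "ennreal (sqrt z) * ?w (0 + sqrt z * v) z =
              h (v * sqrt z, z) * (ennreal (sqrt z) * (ennreal (?\<phi> (v * sqrt z)) * ennreal (?\<gamma> (z - (v * sqrt z)\<^sup>2))))"
            by (simp add: mult_ac)
          also have "\<dots> = ennreal (fb z) * (ennreal (fa v) * h (v * sqrt z, z))"
            unfolding * by (simp add: mult_ac)
          finally show "ennreal (sqrt z) * ?w (0 + sqrt z * v) z = ennreal (fb z) * (ennreal (fa v) * h (v * sqrt z, z))" .
        qed
        finally show ?thesis .
      qed
    qed
    also have "\<dots> = (\<integral>\<^sup>+z. \<integral>\<^sup>+v. h (v * sqrt z, z) \<partial>?A \<partial>?B)"
      by (simp add: nn_integral_density nn_integral_cmult)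
    finally show ?thesis .
  qed
  let ?c = "emeasure ?A UNIV" and ?d = "emeasure ?B UNIV"
  interpret G: prob_space "gamma_distribution a lam" by (rule G)
  interpret N: prob_space "density lborel (\<lambda>y. ennreal (?\<phi> y))"
    using lam by (intro prob_space_normal_density) simp
  have "(\<integral>\<^sup>+y. ennreal (?\<phi> y) \<partial>lborel) = 1"
    using N.emeasure_space_1 by (simp add: emeasure_density)
  then have cd: "?c * ?d = 1"
    using polar[of "\<lambda>_. 1"] G.emeasure_space_1 by simp
  then have d: "?d \<noteq> 0" by auto
  have dc: "?d * ?c = 1" using cd by (simp add: mult.commute)
  \<comment> \<open>the total masses are reciprocal to each other, so each normalises the other factor\<close>
  let ?\<pi> = "density ?A (\<lambda>_. ?d)" and ?\<nu> = "density ?B (\<lambda>_. ?c)"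
  have AE\<pi>: "AE v in ?\<pi>. \<bar>v\<bar> < 1"
    by (auto simp: AE_density fa_def)
  show ?thesis
  proof (intro exI conjI ballI)
    show "prob_space ?\<pi>"
      by (rule prob_spaceI) (simp add: emeasure_density_const dc)
    show "prob_space ?\<nu>"
      by (rule prob_spaceI) (simp add: emeasure_density_const cd)
    show "AE v in ?\<pi>. \<bar>v\<bar> \<le> 1"
      using AE\<pi> by eventually_elim simp
    show "AE z in ?\<nu>. 0 < z"
      by (auto simp: AE_density fb_def)
    show "0 < emeasure ?\<pi> {0..}"
    proof (rule ccontr)
      have fa0: "fa v \<noteq> 0" if "0 \<le> v" "v < 1" for v
        using that abs_square_less_1[of v] by (auto simp: fa_def)
      assume "\<not> 0 < emeasure ?\<pi> {0..}"
      then have "AE v in ?\<pi>. v \<notin> {0..}"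
        by (intro AE_not_in null_setsI) auto
      then have "AE v in lborel. fa v \<noteq> 0 \<longrightarrow> v \<notin> {0..}"
        using d nn by (auto simp: AE_density order.strict_iff_order)
      then have "AE v in lborel. v \<notin> {0..<1::real}"
        by eventually_elim (auto simp: fa0)
      then have "emeasure lborel {0..<1::real} = 0"
        by (subst (asm) AE_iff_measurable[where N="{0..<1}"]) auto
      then show False by simp
    qed
    fix h :: "real \<times> real \<Rightarrow> ennreal" assume h[measurable]: "h \<in> borel_measurable (borel \<Otimes>\<^sub>M borel)"
    have inner: "(\<integral>\<^sup>+v. h (v * sqrt z, z) \<partial>?\<pi>) = ?d * (\<integral>\<^sup>+v. h (v * sqrt z, z) \<partial>?A)" for z
      by (subst nn_integral_density) (auto simp: nn_integral_cmult)
    have "(\<integral>\<^sup>+z. \<integral>\<^sup>+v. h (v * sqrt z, z) \<partial>?\<pi> \<partial>?\<nu>) = (\<integral>\<^sup>+z. ?c * (?d * (\<integral>\<^sup>+v. h (v * sqrt z, z) \<partial>?A)) \<partial>?B)"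
      unfolding inner by (subst nn_integral_density) (simp_all add: nn_integral_density)
    also have "\<dots> = (\<integral>\<^sup>+z. \<integral>\<^sup>+v. h (v * sqrt z, z) \<partial>?A \<partial>?B)"
      by (simp add: mult.assoc[symmetric] cd)
    finally show "(\<integral>\<^sup>+g. \<integral>\<^sup>+y. h (y, g + y\<^sup>2) * ennreal (?\<phi> y) \<partial>lborel \<partial>gamma_distribution a lam) =
      (\<integral>\<^sup>+z. \<integral>\<^sup>+v. h (v * sqrt z, z) \<partial>?\<pi> \<partial>?\<nu>)"
      using polar[OF h] by simp
  qed simp_all
qed

lemma polar_decomposition:
  assumes a: "0 \<le> a" and lam: "0 < lam" and G: "prob_space (gamma_distribution a lam)"
  shows "\<exists>\<pi> \<nu> :: real measure. prob_space \<pi> \<and> prob_space \<nu> \<and> sets \<pi> = sets borel \<and> sets \<nu> = sets borel \<and>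
    (AE v in \<pi>. \<bar>v\<bar> \<le> 1) \<and> 0 < emeasure \<pi> {0..} \<and> (AE z in \<nu>. 0 < z) \<and>
    (\<forall>h \<in> borel_measurable (borel \<Otimes>\<^sub>M borel).
      (\<integral>\<^sup>+g. \<integral>\<^sup>+y. h (y, g + y\<^sup>2) * ennreal (normal_density 0 (1 / sqrt (2 * lam)) y) \<partial>lborel \<partial>gamma_distribution a lam) =
      (\<integral>\<^sup>+z. \<integral>\<^sup>+v. h (v * sqrt z, z) \<partial>\<pi> \<partial>\<nu>))"
proof (cases "a = 0")
  case False
  then show ?thesis using polar_decomposition_gamma[OF _ lam G] a by simp
next
  case True
  have "(\<integral>\<^sup>+g. \<integral>\<^sup>+y. h (y, g + y\<^sup>2) * ennreal (normal_density 0 (1 / sqrt (2 * lam)) y) \<partial>lborel \<partial>gamma_distribution a lam) =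
      (\<integral>\<^sup>+y. h (y, y\<^sup>2) * ennreal (normal_density 0 (1 / sqrt (2 * lam)) y) \<partial>lborel)"
    if [measurable]: "h \<in> borel_measurable (borel \<Otimes>\<^sub>M borel)" for h
    unfolding gamma_distribution_def using True by (simp add: nn_integral_return)
  then show ?thesis
    using polar_decomposition_rademacher[OF lam] by simp
qed

lemma gamma_distribution_moment:
  assumes a: "0 \<le> a" and lam: "0 < lam"
  shows "AE g in gamma_distribution a lam. 0 \<le> g" "integrable (gamma_distribution a lam) (\<lambda>g. g)"
proof -
  let ?\<gamma> = "gamma_density a lam"
  have m[measurable]: "?\<gamma> \<in> borel_measurable borel"
    unfolding gamma_density_def by measurable
  show "AE g in gamma_distribution a lam. 0 \<le> g"
  proof (cases "a = 0")
    case True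
    have "AE g in return borel (0::real). 0 \<le> g" by (subst AE_return) auto
    then show ?thesis unfolding gamma_distribution_def if_P[OF True] .
  next
    case False
    have "AE g in density lborel (\<lambda>x. ennreal (?\<gamma> x)). 0 \<le> g"
      by (auto simp: AE_density gamma_density_def)
    then show ?thesis unfolding gamma_distribution_def if_not_P[OF False] .
  qed
  show "integrable (gamma_distribution a lam) (\<lambda>g. g)"
  proof (cases "a = 0")
    case True
    then show ?thesis by (simp add: gamma_distribution_def integrable_iff_bounded nn_integral_return)
  next
    case False
    then have a: "0 < a" using a by simp
    have Gpos: "0 < Gamma a" using a by (simp add: Gamma_real_pos)
    have nn: "0 \<le> ?\<gamma> x" for x using Gpos by (auto simp: gamma_density_def)
    have "(\<integral>\<^sup>+x. ennreal (?\<gamma> x * x) \<partial>lborel) = ennreal (1 / lam) * (\<integral>\<^sup>+t. ennreal (?\<gamma> (t / lam) * (t / lam)) \<partial>lborel)"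
      using lam by (subst nn_integral_real_affine[where c="1/lam" and t=0]) auto
    also have "(\<integral>\<^sup>+t. ennreal (?\<gamma> (t / lam) * (t / lam)) \<partial>lborel) =
       (\<integral>\<^sup>+t. ennreal (1 / Gamma a) * ennreal (indicator {0..} t * t powr (a + 1 - 1) / exp t) \<partial>lborel)"
    proof (rule nn_integral_cong)
      fix t :: real
      have "?\<gamma> (t / lam) * (t / lam) = 1 / Gamma a * (indicator {0..} t * t powr (a + 1 - 1) / exp t)"
      proof (cases "0 < t")
        case True
        have "lam powr a = lam powr (a - 1) * lam" "t powr a = t powr (a - 1) * t"
          using True lam by (simp_all add: powr_diff)
        then show ?thesis
          using True lam by (simp add: gamma_density_def powr_divide exp_minus field_simps)
      qed (auto simp: gamma_density_def indicator_def divide_simps lam)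
      then show "ennreal (?\<gamma> (t / lam) * (t / lam)) = ennreal (1 / Gamma a) * ennreal (indicator {0..} t * t powr (a + 1 - 1) / exp t)"
        using Gpos by (simp add: ennreal_mult'[symmetric] del: times_divide_eq_left)
    qed
    also have "\<dots> = ennreal (1 / Gamma a) * ennreal (Gamma (a + 1))"
      using a by (subst Gamma_conv_nn_integral_real) (auto simp: nn_integral_cmult)
    finally have "(\<integral>\<^sup>+x. ennreal (?\<gamma> x * x) \<partial>lborel) < \<infinity>"
      by (simp add: ennreal_mult_less_top)
    moreover have "0 \<le> ?\<gamma> x * x" for x
      using nn[of x] by (cases "0 \<le> x") (auto simp: gamma_density_def)
    ultimately have "integrable lborel (\<lambda>x. ?\<gamma> x * x)"
      by (intro integrableI_nonneg) auto
    then show ?thesis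
      using False nn by (simp add: gamma_distribution_def integrable_real_density)
  qed
qed

section \<open>Exponentially tilted priors\<close>

text \<open>
  The logarithm of the likelihood ratio between a Gaussian of variance \<open>1 / (2 lam)\<close> centred at
  \<open>sqrt (s x)\<close> and one centred at \<open>0\<close>, at the point \<open>v \<rho>\<close>.
\<close>

definition tilt_exponent :: "real \<Rightarrow> real \<Rightarrow> real \<Rightarrow> real \<Rightarrow> real \<Rightarrow> real" where
  "tilt_exponent lam s \<rho> x v = lam * (2 * sqrt (s * x) * v * \<rho> - s * x)"

lemma tilt_exponent_le:
  assumes "0 \<le> lam" "0 \<le> s" "0 \<le> x" "\<bar>v\<bar> \<le> 1"
  shows "tilt_exponent lam s \<rho> x v \<le> lam * \<rho>\<^sup>2"
proof -
  have "0 \<le> (\<rho> - sqrt (s * x) * v)\<^sup>2 + s * x * (1 - v\<^sup>2)"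
    using assms abs_square_le_1[of v] by auto
  also have "\<dots> = \<rho>\<^sup>2 - (2 * sqrt (s * x) * v * \<rho> - s * x)"
    using assms by (simp add: power2_diff power_mult_distrib algebra_simps)
  finally show ?thesis
    unfolding tilt_exponent_def using assms by (intro mult_left_mono) auto
qed

text \<open>
  The radius \<open>\<rho>\<close> moves with \<open>s\<close>; \<open>x0\<close> is the input that drives the trajectory, whereas \<open>x\<close> is a
  competing input over which the prior will be integrated.
\<close>

lemma tilt_exponent_lipschitz:
  assumes lam: "0 \<le> lam" and r: "0 < r"
    and s1: "r / 2 \<le> s1" "s1 \<le> 2 * r" and s2: "r / 2 \<le> s2" "s2 \<le> 2 * r"
    and x: "0 \<le> x" and x0: "0 \<le> x0" and \<rho>1: "0 \<le> \<rho>1" and v: "\<bar>v\<bar> \<le> 1"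
    and \<rho>: "\<bar>\<rho>1 - \<rho>2\<bar> \<le> sqrt x0 * \<bar>sqrt s1 - sqrt s2\<bar>"
  shows "\<bar>tilt_exponent lam s1 \<rho>1 x v - tilt_exponent lam s2 \<rho>2 x v\<bar>
    \<le> \<bar>s1 - s2\<bar> * (lam * (2 * x + 2 * \<rho>1\<^sup>2 / r + 4 * x0))"
proof -
  define a b q y d where "a = sqrt s1" and "b = sqrt s2" and "q = sqrt (r / 2)" and "y = sqrt x0" and "d = \<bar>s1 - s2\<bar>"
  have q: "0 < q" using r by (simp add: q_def)
  have q2: "q\<^sup>2 = r / 2" using r by (simp add: q_def)
  have ab: "q \<le> a" "q \<le> b" using s1 s2 by (auto simp: a_def b_def q_def)
  have "b \<le> sqrt (4 * (r / 2))" using s2 by (simp add: b_def)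
  also have "\<dots> = 2 * q" by (simp only: real_sqrt_mult real_sqrt_four q_def)
  finally have b2: "b \<le> 2 * q" .
  have y: "0 \<le> y" "y\<^sup>2 = x0" using x0 by (auto simp: y_def)
  have sq: "a\<^sup>2 = s1" "b\<^sup>2 = s2" using s1 s2 r by (auto simp: a_def b_def)
  have "d = \<bar>(a - b) * (a + b)\<bar>"
    by (simp add: d_def sq[symmetric] power2_eq_square algebra_simps)
  also have "\<dots> = \<bar>a - b\<bar> * (a + b)" using ab q by (simp add: abs_mult)
  also have "\<dots> \<ge> \<bar>a - b\<bar> * (2 * q)" using ab by (intro mult_left_mono) auto
  finally have dq: "\<bar>a - b\<bar> * (2 * q) \<le> d" .
  have "\<bar>a * \<rho>1 - b * \<rho>2\<bar> = \<bar>(a - b) * \<rho>1 + b * (\<rho>1 - \<rho>2)\<bar>" by (simp add: algebra_simps)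
  also have "\<dots> \<le> \<bar>a - b\<bar> * \<rho>1 + b * \<bar>\<rho>1 - \<rho>2\<bar>"
    using ab q \<rho>1 by (intro order_trans[OF abs_triangle_ineq]) (simp add: abs_mult)
  also have "b * \<bar>\<rho>1 - \<rho>2\<bar> \<le> 2 * q * (y * \<bar>a - b\<bar>)"
    using b2 \<rho> ab q y by (intro mult_mono) (auto simp: a_def b_def y_def)
  finally have 1: "\<bar>a * \<rho>1 - b * \<rho>2\<bar> \<le> \<bar>a - b\<bar> * (\<rho>1 + 2 * q * y)"
    by (simp add: algebra_simps)
  have p: "0 \<le> \<rho>1 + 2 * q * y" using \<rho>1 q y by simp
  have "2 * sqrt x * \<bar>a * \<rho>1 - b * \<rho>2\<bar> \<le> 2 * sqrt x * (\<bar>a - b\<bar> * (\<rho>1 + 2 * q * y))"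
    using 1 x by (intro mult_left_mono) auto
  also have "\<dots> = (\<bar>a - b\<bar> * (2 * q)) * (sqrt x * ((\<rho>1 + 2 * q * y) / q))"
    using q by simp
  also have "\<dots> \<le> d * (sqrt x * ((\<rho>1 + 2 * q * y) / q))"
    using dq p q x by (intro mult_right_mono) auto
  also have "\<dots> \<le> d * (x + 2 * \<rho>1\<^sup>2 / r + 4 * x0)"
  proof (rule mult_left_mono)
    let ?w = "(\<rho>1 + 2 * q * y) / q"
    have "2 * (sqrt x * ?w) \<le> (sqrt x)\<^sup>2 + ?w\<^sup>2"
      using sum_squares_bound[of "sqrt x" ?w] by simp
    also have "(\<rho>1 + 2 * q * y)\<^sup>2 \<le> 2 * \<rho>1\<^sup>2 + 8 * (q\<^sup>2 * y\<^sup>2)"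
      using sum_squares_bound[of \<rho>1 "2 * q * y"] by (simp add: power2_sum power_mult_distrib)
    then have "?w\<^sup>2 \<le> (2 * \<rho>1\<^sup>2 + 8 * (q\<^sup>2 * y\<^sup>2)) / q\<^sup>2"
      using q by (simp add: power_divide divide_right_mono)
    also have "\<dots> = 4 * \<rho>1\<^sup>2 / r + 8 * x0"
      using r by (simp add: q2 y field_simps)
    finally show "sqrt x * ?w \<le> x + 2 * \<rho>1\<^sup>2 / r + 4 * x0"
      using x by simp
  qed (simp add: d_def)
  finally have 2: "2 * sqrt x * \<bar>a * \<rho>1 - b * \<rho>2\<bar> \<le> d * (x + 2 * \<rho>1\<^sup>2 / r + 4 * x0)" .
  have "tilt_exponent lam s1 \<rho>1 x v - tilt_exponent lam s2 \<rho>2 x v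
      = lam * (v * (2 * sqrt x * (a * \<rho>1 - b * \<rho>2)) - (s1 - s2) * x)"
    by (simp add: tilt_exponent_def a_def b_def real_sqrt_mult algebra_simps)
  then have "\<bar>tilt_exponent lam s1 \<rho>1 x v - tilt_exponent lam s2 \<rho>2 x v\<bar>
      = lam * \<bar>v * (2 * sqrt x * (a * \<rho>1 - b * \<rho>2)) - (s1 - s2) * x\<bar>"
    using lam by (simp add: abs_mult)
  also have "\<dots> \<le> lam * (\<bar>v\<bar> * (2 * sqrt x * \<bar>a * \<rho>1 - b * \<rho>2\<bar>) + d * x)"
    using lam x by (intro mult_left_mono order_trans[OF abs_triangle_ineq4]) (auto simp: abs_mult d_def)
  also have "\<dots> \<le> lam * (1 * (2 * sqrt x * \<bar>a * \<rho>1 - b * \<rho>2\<bar>) + d * x)"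
    using lam x v by (intro mult_left_mono add_right_mono mult_right_mono) auto
  also have "\<dots> \<le> lam * (d * (x + 2 * \<rho>1\<^sup>2 / r + 4 * x0) + d * x)"
    using 2 lam by (intro mult_left_mono) auto
  also have "\<dots> = d * (lam * (2 * x + 2 * \<rho>1\<^sup>2 / r + 4 * x0))"
    by (simp add: algebra_simps)
  finally show ?thesis by (simp add: d_def)
qed

lemma radius_lipschitz:
  assumes "0 \<le> (g::real)"
  shows "\<bar>sqrt (g + u\<^sup>2) - sqrt (g + w\<^sup>2)\<bar> \<le> \<bar>u - w\<bar>"
proof -
  have "\<bar>norm (Complex (sqrt g) u) - norm (Complex (sqrt g) w)\<bar> \<le> norm (Complex (sqrt g) u - Complex (sqrt g) w)"
    by (rule norm_triangle_ineq3)
  then show ?thesis using assms by (simp add: cmod_def)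
qed

lemma abs_exp_diff_le: "\<bar>exp a - exp b\<bar> \<le> \<bar>a - b\<bar> * c" if "exp a \<le> c" "exp b \<le> c" for a b c :: real
proof -
  have *: "exp a - exp b \<le> \<bar>a - b\<bar> * c" if "exp a \<le> c" "exp b \<le> c" for a b :: real
  proof -
    have "exp a * (1 + (b - a)) \<le> exp a * exp (b - a)" by (intro mult_left_mono) auto
    also have "\<dots> = exp b" by (simp add: exp_add[symmetric])
    finally have "exp a - exp b \<le> (a - b) * exp a" by (simp add: algebra_simps)
    also have "\<dots> \<le> \<bar>a - b\<bar> * exp a" by (intro mult_right_mono) auto
    also have "\<dots> \<le> \<bar>a - b\<bar> * c" using that by (intro mult_left_mono) auto
    finally show ?thesis .
  qed
  show ?thesis using *[of a b] *[of b a] that by (auto simp: abs_le_iff abs_minus_commute)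
qed

text \<open>
  A prior for the pair of input and ratio.  Two instances are used: the law of the input times
  \<open>\<pi>\<close>, whose partition function is the \<open>\<nu>\<close>-density of the output, and a Dirac measure at a given
  input times \<open>\<pi>\<close>, whose partition function is its \<open>\<nu>\<close>-density given that input.
  Treating both at once makes one derivative formula serve for the two logarithms in the
  information density.
\<close>

locale amplitude_prior = prob_space \<kappa> for \<kappa> :: "(real \<times> real) measure" +
  fixes lam :: real
  assumes sets_\<kappa>[measurable_cong]: "sets \<kappa> = sets (borel \<Otimes>\<^sub>M borel)"
    and support: "AE t in \<kappa>. 0 < fst t \<and> \<bar>snd t\<bar> \<le> 1"
    and mean: "integrable \<kappa> fst"
    and positive: "0 < emeasure \<kappa> {t. 0 \<le> snd t}"
    and lam: "0 < lam"
begin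

abbreviation weight :: "real \<Rightarrow> real \<Rightarrow> real \<times> real \<Rightarrow> real" where
  "weight s \<rho> t \<equiv> exp (tilt_exponent lam s \<rho> (fst t) (snd t))"

definition partition :: "real \<Rightarrow> real \<Rightarrow> real" where
  "partition s \<rho> = (\<integral>t. weight s \<rho> t \<partial>\<kappa>)"

lemma space_\<kappa>: "space \<kappa> = UNIV"
  using sets_eq_imp_space_eq[OF sets_\<kappa>] by (simp add: space_pair_measure)

lemma weight_measurable[measurable]: "weight s \<rho> \<in> borel_measurable \<kappa>"
  unfolding tilt_exponent_def by measurable

lemma weight_le:
  assumes "0 \<le> s"
  shows "AE t in \<kappa>. weight s \<rho> t \<le> exp (lam * \<rho>\<^sup>2)"
  using support
proof eventually_elim
  case (elim t)
  then show ?case using tilt_exponent_le[of lam s "fst t" "snd t" \<rho>] lam assms by simp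
qed

lemma integrable_weight:
  assumes "0 \<le> s"
  shows "integrable \<kappa> (weight s \<rho>)"
  by (rule integrable_const_bound[OF _ weight_measurable, where B="exp (lam * \<rho>\<^sup>2)"])
     (use weight_le[OF assms, of \<rho>] in simp)

lemma integrable_mult_weight:
  assumes "0 \<le> s" and f: "integrable \<kappa> f"
  shows "integrable \<kappa> (\<lambda>t. f t * weight s \<rho> t)"
proof (rule Bochner_Integration.integrable_bound)
  show "integrable \<kappa> (\<lambda>t. f t * exp (lam * \<rho>\<^sup>2))" using f by simp
  have [measurable]: "f \<in> borel_measurable \<kappa>" using f by simp
  show "(\<lambda>t. f t * weight s \<rho> t) \<in> borel_measurable \<kappa>" by measurable
  show "AE t in \<kappa>. norm (f t * weight s \<rho> t) \<le> norm (f t * exp (lam * \<rho>\<^sup>2))"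
    using weight_le[OF assms(1), of \<rho>]
    by eventually_elim (simp add: abs_mult mult_left_mono)
qed

lemma integrable_sqrt_amplitude: "integrable \<kappa> (\<lambda>t. sqrt (fst t) * snd t)"
proof (rule Bochner_Integration.integrable_bound)
  show "integrable \<kappa> (\<lambda>t. 1 + fst t)" using mean by simp
  show "AE t in \<kappa>. norm (sqrt (fst t) * snd t) \<le> norm (1 + fst t)"
    using support
  proof eventually_elim
    case (elim t)
    have "sqrt (fst t) * \<bar>snd t\<bar> \<le> sqrt (fst t) * 1"
      using elim by (intro mult_left_mono) auto
    also have "\<dots> \<le> 1 + fst t"
      using elim sum_squares_bound[of "sqrt (fst t)" 1] by simp
    finally show ?case using elim by (simp add: abs_mult)
  qed
qed measurable

lemma partition_pos:
  assumes "0 \<le> s"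
  shows "0 < partition s \<rho>"
proof -
  have "partition s \<rho> \<noteq> 0"
    unfolding partition_def
    by (subst integral_nonneg_eq_0_iff_AE) (use integrable_weight[OF assms] not_AE_zero_E in \<open>auto simp: AE_False\<close>)
  moreover have "0 \<le> partition s \<rho>" unfolding partition_def by simp
  ultimately show ?thesis by simp
qed

text \<open>
  For a nonnegative ratio the exponent is at least \<open>- lam s x\<close>, whatever the radius, so the part of
  the prior on the half-space \<open>v \<ge> 0\<close> bounds the partition function from below uniformly.
\<close>

lemma partition_lower_bound:
  assumes r: "0 < r"
  obtains c where "0 < c" "\<And>s \<rho>. 0 \<le> s \<Longrightarrow> s \<le> 2 * r \<Longrightarrow> 0 \<le> \<rho> \<Longrightarrow> c \<le> partition s \<rho>"
proof
  let ?H = "{t::real \<times> real. 0 \<le> snd t}"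
  let ?f = "\<lambda>t. indicator ?H t * exp (- (lam * (2 * r * fst t)))"
  have "{t \<in> space (borel \<Otimes>\<^sub>M borel). 0 \<le> snd (t :: real \<times> real)} \<in> sets (borel \<Otimes>\<^sub>M borel)"
    by measurable
  then have H[measurable]: "?H \<in> sets \<kappa>" by (simp add: sets_\<kappa> space_pair_measure)
  have f: "integrable \<kappa> ?f"
  proof (rule integrable_const_bound[where B=1])
    show "AE t in \<kappa>. norm (?f t) \<le> 1"
      using support by eventually_elim (use lam r in \<open>auto simp: indicator_def\<close>)
  qed measurable
  have "(\<integral>t. ?f t \<partial>\<kappa>) \<noteq> 0"
  proof
    assume "(\<integral>t. ?f t \<partial>\<kappa>) = 0"
    then have "AE t in \<kappa>. t \<notin> ?H"
      using f by (subst (asm) integral_nonneg_eq_0_iff_AE) (auto simp: indicator_def)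
    then have "emeasure \<kappa> ?H = 0"
      by (subst (asm) AE_iff_measurable[where N="?H"]) (auto simp: space_\<kappa>)
    with positive show False by simp
  qed
  moreover have "0 \<le> (\<integral>t. ?f t \<partial>\<kappa>)" by (intro integral_nonneg_AE) auto
  ultimately show "0 < (\<integral>t. ?f t \<partial>\<kappa>)" by linarith
  fix s \<rho> :: real assume s: "0 \<le> s" "s \<le> 2 * r" and \<rho>: "0 \<le> \<rho>"
  show "(\<integral>t. ?f t \<partial>\<kappa>) \<le> partition s \<rho>"
    unfolding partition_def
  proof (rule integral_mono_AE[OF f integrable_weight[OF s(1)]])
    show "AE t in \<kappa>. ?f t \<le> weight s \<rho> t"
      using support
    proof eventually_elim
      case (elim t)
      show ?case
      proof (cases "t \<in> ?H")
        case True
        have "- (lam * (2 * r * fst t)) \<le> - (lam * (s * fst t))"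
          using lam elim s by (simp add: mult_right_mono)
        also have "\<dots> \<le> tilt_exponent lam s \<rho> (fst t) (snd t)"
          using True s \<rho> elim lam by (simp add: tilt_exponent_def right_diff_distrib)
        finally show ?thesis using True by simp
      qed simp
    qed
  qed
qed

text \<open>
  Where \<open>s x > 16 \<rho>\<^sup>2\<close> the exponent is at most \<open>- lam s x / 2\<close>, so these inputs contribute a
  bounded amount to the mean; the others are at most \<open>16 \<rho>\<^sup>2 / s\<close>.
\<close>

lemma posterior_mean_bound:
  assumes r: "0 < r"
  obtains A B where "0 \<le> A" "0 \<le> B"
    "\<And>s \<rho>. r / 2 \<le> s \<Longrightarrow> s \<le> 2 * r \<Longrightarrow> 0 \<le> \<rho> \<Longrightarrow>
      (\<integral>t. fst t * weight s \<rho> t \<partial>\<kappa>) \<le> (A + B * \<rho>\<^sup>2) * partition s \<rho>"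
proof -
  obtain c where c: "0 < c" "\<And>s \<rho>. 0 \<le> s \<Longrightarrow> s \<le> 2 * r \<Longrightarrow> 0 \<le> \<rho> \<Longrightarrow> c \<le> partition s \<rho>"
    using partition_lower_bound[OF r] by blast
  show ?thesis
  proof (rule that)
    show "0 \<le> 4 / (lam * r * c)" "0 \<le> 32 / r" using r c lam by auto
    fix s \<rho> :: real assume s: "r / 2 \<le> s" "s \<le> 2 * r" and \<rho>: "0 \<le> \<rho>"
    then have s0: "0 < s" using r by linarith
    have "(\<integral>t. fst t * weight s \<rho> t \<partial>\<kappa>) \<le> (\<integral>t. (16 * \<rho>\<^sup>2 / s) * weight s \<rho> t + 2 / (lam * s) \<partial>\<kappa>)"
    proof (rule integral_mono_AE)
      show "AE t in \<kappa>. fst t * weight s \<rho> t \<le> (16 * \<rho>\<^sup>2 / s) * weight s \<rho> t + 2 / (lam * s)"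
        using support
      proof eventually_elim
        case (elim t)
        define x v where "x = fst t" and "v = snd t"
        have x: "0 < x" and v: "\<bar>v\<bar> \<le> 1" using elim by (auto simp: x_def v_def)
        show ?case
        proof (cases "s * x \<le> 16 * \<rho>\<^sup>2")
          case True
          then have "x \<le> 16 * \<rho>\<^sup>2 / s" using s0 by (simp add: field_simps)
          then have "x * weight s \<rho> t \<le> (16 * \<rho>\<^sup>2 / s) * weight s \<rho> t"
            by (intro mult_right_mono) auto
          moreover have "0 \<le> 2 / (lam * s)" using lam s0 by simp
          ultimately show ?thesis unfolding x_def by linarith
        next
          case False
          define w where "w = sqrt (s * x)"
          have w: "w\<^sup>2 = s * x" "0 \<le> w" using s0 x by (auto simp: w_def)
          have "(4 * \<rho>)\<^sup>2 \<le> w\<^sup>2" using False w by (simp add: power_mult_distrib)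
          then have "4 * \<rho> \<le> w" using w(2) by (rule power2_le_imp_le)
          have "v * \<rho> \<le> 1 * \<rho>" using v \<rho> by (intro mult_right_mono) auto
          then have "2 * w * (v * \<rho>) \<le> 2 * w * (w / 4)"
            using \<open>4 * \<rho> \<le> w\<close> w(2) by (intro mult_left_mono) auto
          then have "2 * w * v * \<rho> - s * x \<le> - (s * x / 2)"
            using w(1) by (simp add: power2_eq_square)
          then have "lam * (2 * w * v * \<rho> - s * x) \<le> lam * - (s * x / 2)"
            using lam by (intro mult_left_mono) auto
          then have "weight s \<rho> t \<le> exp (- (lam * s * x / 2))"
            by (simp add: tilt_exponent_def w_def x_def v_def)
          then have "x * weight s \<rho> t \<le> x * exp (- (lam * s * x / 2))"
            using x by (intro mult_left_mono) auto
          also have "\<dots> = 2 / (lam * s) * ((lam * s * x / 2) * exp (- (lam * s * x / 2)))"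
            using lam s0 by simp
          also have "\<dots> \<le> 2 / (lam * s) * 1"
          proof (rule mult_left_mono)
            have "lam * s * x / 2 \<le> exp (lam * s * x / 2)"
              using exp_ge_add_one_self[of "lam * s * x / 2"] by linarith
            then show "lam * s * x / 2 * exp (- (lam * s * x / 2)) \<le> 1"
              by (simp add: exp_minus field_simps)
          qed (use lam s0 in auto)
          finally have "x * weight s \<rho> t \<le> 2 / (lam * s)" by simp
          moreover have "0 \<le> (16 * \<rho>\<^sup>2 / s) * weight s \<rho> t" using s0 by simp
          ultimately show ?thesis unfolding x_def by linarith
        qed
      qed
    qed (use integrable_weight integrable_mult_weight mean s0 in auto)
    also have "\<dots> = (16 * \<rho>\<^sup>2 / s) * partition s \<rho> + 2 / (lam * s)"
      using integrable_weight[of s \<rho>] s0 by (simp add: partition_def prob_space)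
    also have "\<dots> \<le> (32 / r * \<rho>\<^sup>2) * partition s \<rho> + 4 / (lam * r * c) * partition s \<rho>"
    proof (rule add_mono)
      have "16 * \<rho>\<^sup>2 / s \<le> 16 * \<rho>\<^sup>2 / (r / 2)"
        using s r by (intro divide_left_mono) auto
      then show "(16 * \<rho>\<^sup>2 / s) * partition s \<rho> \<le> (32 / r * \<rho>\<^sup>2) * partition s \<rho>"
        using partition_pos[of s \<rho>] s0 by (intro mult_right_mono) auto
      have "2 / (lam * s) \<le> 2 / (lam * (r / 2))"
        using s r lam by (intro divide_left_mono) auto
      also have "\<dots> = 4 / (lam * r * c) * c" using c by simp
      also have "\<dots> \<le> 4 / (lam * r * c) * partition s \<rho>"
        using c s s0 \<rho> lam r by (intro mult_left_mono) auto
      finally show "2 / (lam * s) \<le> 4 / (lam * r * c) * partition s \<rho>" .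
    qed
    also have "\<dots> = (4 / (lam * r * c) + 32 / r * \<rho>\<^sup>2) * partition s \<rho>"
      by (simp add: algebra_simps)
    finally show "(\<integral>t. fst t * weight s \<rho> t \<partial>\<kappa>) \<le> (4 / (lam * r * c) + 32 / r * \<rho>\<^sup>2) * partition s \<rho>" .
  qed
qed

lemma ln_partition_diff_le:
  assumes r: "0 < r" and s1: "r / 2 \<le> s1" "s1 \<le> 2 * r" and s2: "r / 2 \<le> s2" "s2 \<le> 2 * r"
    and x0: "0 \<le> x0" and \<rho>1: "0 \<le> \<rho>1"
    and \<rho>: "\<bar>\<rho>1 - \<rho>2\<bar> \<le> sqrt x0 * \<bar>sqrt s1 - sqrt s2\<bar>"
    and K: "(\<integral>t. fst t * weight s1 \<rho>1 t \<partial>\<kappa>) \<le> K * partition s1 \<rho>1"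
  shows "ln (partition s1 \<rho>1) - ln (partition s2 \<rho>2)
    \<le> \<bar>s1 - s2\<bar> * (lam * (2 * K + 2 * \<rho>1\<^sup>2 / r + 4 * x0))"
  unfolding partition_def
proof (rule ln_integral_exp_diff_le[where b="\<lambda>t. lam * (2 * fst t + (2 * \<rho>1\<^sup>2 / r + 4 * x0))"])
  have s0: "0 \<le> s1" "0 \<le> s2" using s1 s2 r by auto
  note [simp] = integrable_weight[OF s0(1)] integrable_weight[OF s0(2)] integrable_mult_weight[OF s0(1) mean]
  show "integrable \<kappa> (weight s1 \<rho>1)" "integrable \<kappa> (weight s2 \<rho>2)" by simp_all
  show "0 < (\<integral>t. weight s1 \<rho>1 t \<partial>\<kappa>)"
    using partition_pos[OF s0(1), of \<rho>1] by (simp add: partition_def)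
  show "AE t in \<kappa>. tilt_exponent lam s1 \<rho>1 (fst t) (snd t) - tilt_exponent lam s2 \<rho>2 (fst t) (snd t)
      \<le> \<bar>s1 - s2\<bar> * (lam * (2 * fst t + (2 * \<rho>1\<^sup>2 / r + 4 * x0)))"
    using support
  proof eventually_elim
    case (elim t)
    then show ?case
      using tilt_exponent_lipschitz[OF _ r s1 s2 _ x0 \<rho>1 _ \<rho>, of lam "fst t" "snd t"] lam
      by (auto simp: add.assoc)
  qed
  have eq: "lam * (2 * fst t + (2 * \<rho>1\<^sup>2 / r + 4 * x0)) * weight s1 \<rho>1 t =
      2 * lam * (fst t * weight s1 \<rho>1 t) + lam * (2 * \<rho>1\<^sup>2 / r + 4 * x0) * weight s1 \<rho>1 t" for t
    by (simp add: algebra_simps)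
  show "integrable \<kappa> (\<lambda>t. lam * (2 * fst t + (2 * \<rho>1\<^sup>2 / r + 4 * x0)) * weight s1 \<rho>1 t)"
    unfolding eq by simp
  have "(\<integral>t. lam * (2 * fst t + (2 * \<rho>1\<^sup>2 / r + 4 * x0)) * weight s1 \<rho>1 t \<partial>\<kappa>) =
      2 * lam * (\<integral>t. fst t * weight s1 \<rho>1 t \<partial>\<kappa>) + lam * (2 * \<rho>1\<^sup>2 / r + 4 * x0) * partition s1 \<rho>1"
    unfolding eq partition_def by simp
  also have "\<dots> \<le> 2 * lam * (K * partition s1 \<rho>1) + lam * (2 * \<rho>1\<^sup>2 / r + 4 * x0) * partition s1 \<rho>1"
    using K lam by (intro add_right_mono mult_left_mono) auto
  also have "\<dots> = lam * (2 * K + 2 * \<rho>1\<^sup>2 / r + 4 * x0) * (\<integral>t. weight s1 \<rho>1 t \<partial>\<kappa>)"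
    by (simp add: partition_def[symmetric] algebra_simps)
  finally show "(\<integral>t. lam * (2 * fst t + (2 * \<rho>1\<^sup>2 / r + 4 * x0)) * weight s1 \<rho>1 t \<partial>\<kappa>)
      \<le> lam * (2 * K + 2 * \<rho>1\<^sup>2 / r + 4 * x0) * (\<integral>t. weight s1 \<rho>1 t \<partial>\<kappa>)" .
qed auto

lemma abs_ln_partition_diff_le:
  assumes r: "0 < r" and s1: "r / 2 \<le> s1" "s1 \<le> 2 * r" and s2: "r / 2 \<le> s2" "s2 \<le> 2 * r"
    and x0: "0 \<le> x0" and \<rho>1: "0 \<le> \<rho>1" "\<rho>1\<^sup>2 \<le> Q" and \<rho>2: "0 \<le> \<rho>2" "\<rho>2\<^sup>2 \<le> Q"
    and \<rho>: "\<bar>\<rho>1 - \<rho>2\<bar> \<le> sqrt x0 * \<bar>sqrt s1 - sqrt s2\<bar>"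
    and K1: "(\<integral>t. fst t * weight s1 \<rho>1 t \<partial>\<kappa>) \<le> K * partition s1 \<rho>1"
    and K2: "(\<integral>t. fst t * weight s2 \<rho>2 t \<partial>\<kappa>) \<le> K * partition s2 \<rho>2"
  shows "\<bar>ln (partition s1 \<rho>1) - ln (partition s2 \<rho>2)\<bar> \<le> \<bar>s1 - s2\<bar> * (lam * (2 * K + 2 * Q / r + 4 * x0))"
proof -
  have le: "\<bar>s1 - s2\<bar> * (lam * (2 * K + 2 * q / r + 4 * x0)) \<le> \<bar>s1 - s2\<bar> * (lam * (2 * K + 2 * Q / r + 4 * x0))"
    if "q \<le> Q" for q
    using that lam r by (intro mult_left_mono add_right_mono add_left_mono divide_right_mono) auto
  have \<rho>': "\<bar>\<rho>2 - \<rho>1\<bar> \<le> sqrt x0 * \<bar>sqrt s2 - sqrt s1\<bar>"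
    using \<rho> by (simp add: abs_minus_commute)
  show ?thesis
    using order_trans[OF ln_partition_diff_le[OF r s1 s2 x0 \<rho>1(1) \<rho> K1] le[OF \<rho>1(2)]]
      order_trans[OF ln_partition_diff_le[OF r s2 s1 x0 \<rho>2(1) \<rho>' K2, unfolded abs_minus_commute[of s2 s1]] le[OF \<rho>2(2)]]
    by (simp add: abs_le_iff)
qed

lemma partition_le:
  assumes "0 \<le> s"
  shows "partition s \<rho> \<le> exp (lam * \<rho>\<^sup>2)"
proof -
  have "partition s \<rho> \<le> (\<integral>t. exp (lam * \<rho>\<^sup>2) \<partial>\<kappa>)"
    unfolding partition_def using weight_le[OF assms] integrable_weight[OF assms]
    by (intro integral_mono_AE) auto
  then show ?thesis by (simp add: prob_space)
qed

text \<open>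
  The trajectory \<open>R\<close> has derivative \<open>D / (2 sqrt r)\<close>; for the channel \<open>D\<close> is \<open>sqrt X V\<close>.
\<close>

lemma has_derivative_partition:
  assumes r: "0 < r" and x0: "0 \<le> x0"
    and R0: "\<And>s. 0 \<le> R s"
    and R: "\<And>s. 0 < s \<Longrightarrow> \<bar>R s - R r\<bar> \<le> sqrt x0 * \<bar>sqrt s - sqrt r\<bar>"
    and dR: "(R has_real_derivative D / (2 * sqrt r)) (at r)"
  shows "((\<lambda>s. partition s (R s)) has_real_derivative
    lam * ((R r / sqrt r + D) * (\<integral>t. sqrt (fst t) * snd t * weight r (R r) t \<partial>\<kappa>)
      - (\<integral>t. fst t * weight r (R r) t \<partial>\<kappa>))) (at r)"
proof -
  define B where "B = R r + sqrt x0 * sqrt (2 * r)"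
  have RB: "R s \<le> B" if "0 < s" "s \<le> 2 * r" for s
  proof -
    have "\<bar>sqrt s - sqrt r\<bar> \<le> sqrt (2 * r)"
    proof -
      have "sqrt s \<le> sqrt (2 * r)" "sqrt r \<le> sqrt (2 * r)" "0 \<le> sqrt s" "0 \<le> sqrt r"
        using that r by (auto simp del: real_sqrt_mult)
      then show ?thesis by linarith
    qed
    then have "sqrt x0 * \<bar>sqrt s - sqrt r\<bar> \<le> sqrt x0 * sqrt (2 * r)"
      using x0 by (intro mult_left_mono) auto
    then show ?thesis using R[OF that(1)] by (simp add: B_def)
  qed
  let ?e = "\<lambda>t. lam * ((R r / sqrt r + D) * (sqrt (fst t) * snd t) - fst t)"
  have "((\<lambda>s. \<integral>t. weight s (R s) t \<partial>\<kappa>) has_real_derivative (\<integral>t. ?e t * weight r (R r) t \<partial>\<kappa>)) (at r)"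
  proof (rule has_real_derivative_integral_lipschitz[where e="r/2" and D="\<lambda>t. lam * (2 * fst t + 2 * B\<^sup>2 / r + 4 * x0) * exp (lam * B\<^sup>2)"])
    show "integrable \<kappa> (\<lambda>t. weight s (R s) t)" if "\<bar>s - r\<bar> < r / 2" for s
    proof -
      have "0 \<le> s" using that by linarith
      then show ?thesis by (rule integrable_weight)
    qed
    show "integrable \<kappa> (\<lambda>t. lam * (2 * fst t + 2 * B\<^sup>2 / r + 4 * x0) * exp (lam * B\<^sup>2))"
      using mean by simp
    show "AE t in \<kappa>. ((\<lambda>s. weight s (R s) t) has_real_derivative ?e t * weight r (R r) t) (at r)"
      using support
    proof eventually_elim
      case (elim t)
      have "((\<lambda>s. lam * (2 * (sqrt s * sqrt (fst t)) * snd t * R s - s * fst t)) has_real_derivative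
          lam * (2 * (inverse (sqrt r) / 2 * sqrt (fst t)) * snd t * R r + 2 * (sqrt r * sqrt (fst t)) * snd t * (D / (2 * sqrt r)) - fst t)) (at r)"
        using r by (auto intro!: derivative_eq_intros dR DERIV_real_sqrt simp: algebra_simps)
      also have "lam * (2 * (inverse (sqrt r) / 2 * sqrt (fst t)) * snd t * R r + 2 * (sqrt r * sqrt (fst t)) * snd t * (D / (2 * sqrt r)) - fst t) = ?e t"
        using r by (simp add: field_simps)
      finally have "((\<lambda>s. tilt_exponent lam s (R s) (fst t) (snd t)) has_real_derivative ?e t) (at r)"
        unfolding tilt_exponent_def real_sqrt_mult .
      from DERIV_fun_exp[OF this] show ?case by (simp add: mult.commute)
    qed
    show "AE t in \<kappa>. \<bar>weight s (R s) t - weight r (R r) t\<bar> \<le> \<bar>s - r\<bar> * (lam * (2 * fst t + 2 * B\<^sup>2 / r + 4 * x0) * exp (lam * B\<^sup>2))"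
      if s: "\<bar>s - r\<bar> < r / 2" for s
    proof -
      have s': "r / 2 \<le> s" "s \<le> 2 * r" "0 < s" using s r by linarith+
      have BR: "(R s)\<^sup>2 \<le> B\<^sup>2" "(R r)\<^sup>2 \<le> B\<^sup>2"
        using RB[of s] RB[of r] s' R0[of s] R0[of r] r by (auto intro!: power_mono)
      show ?thesis
        using support weight_le[OF less_imp_le[OF s'(3)], of "R s"] weight_le[OF less_imp_le[OF r], of "R r"]
      proof eventually_elim
        case (elim t)
        have "exp (lam * (R s)\<^sup>2) \<le> exp (lam * B\<^sup>2)" "exp (lam * (R r)\<^sup>2) \<le> exp (lam * B\<^sup>2)"
          using BR lam by auto
        then have "\<bar>weight s (R s) t - weight r (R r) t\<bar> \<le>
            \<bar>tilt_exponent lam s (R s) (fst t) (snd t) - tilt_exponent lam r (R r) (fst t) (snd t)\<bar> * exp (lam * B\<^sup>2)"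
          using elim by (intro abs_exp_diff_le) (auto intro: order_trans)
        also have "\<dots> \<le> \<bar>s - r\<bar> * (lam * (2 * fst t + 2 * (R s)\<^sup>2 / r + 4 * x0)) * exp (lam * B\<^sup>2)"
          using elim s' r lam x0 R0 R[OF s'(3)] by (intro mult_right_mono tilt_exponent_lipschitz) auto
        also have "\<dots> \<le> \<bar>s - r\<bar> * (lam * (2 * fst t + 2 * B\<^sup>2 / r + 4 * x0)) * exp (lam * B\<^sup>2)"
          using BR r lam by (intro mult_right_mono mult_left_mono add_right_mono add_left_mono divide_right_mono) auto
        finally show ?case by (simp add: mult.assoc)
      qed
    qed
  qed (use r in auto)
  also have "(\<integral>t. ?e t * weight r (R r) t \<partial>\<kappa>) =
      (\<integral>t. lam * ((R r / sqrt r + D) * (sqrt (fst t) * snd t * weight r (R r) t) - fst t * weight r (R r) t) \<partial>\<kappa>)"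
    by (simp add: algebra_simps)
  also have "\<dots> = lam * ((R r / sqrt r + D) * (\<integral>t. sqrt (fst t) * snd t * weight r (R r) t \<partial>\<kappa>)
      - (\<integral>t. fst t * weight r (R r) t \<partial>\<kappa>))"
    using integrable_mult_weight[OF _ mean, of r "R r"] integrable_mult_weight[OF _ integrable_sqrt_amplitude, of r "R r"] r by simp
  finally show ?thesis unfolding partition_def .
qed

end

section \<open>The channel as an exponentially tilted measure\<close>

lemma tilt_exponent_ge:
  assumes "0 \<le> lam" "0 \<le> s" "0 \<le> x" "\<bar>v\<bar> \<le> 1"
  shows "- (lam * (\<rho>\<^sup>2 + 2 * (s * x))) \<le> tilt_exponent lam s \<rho> x v"
proof -
  have "0 \<le> (\<rho> + sqrt (s * x) * v)\<^sup>2 + s * x * (1 - v\<^sup>2)"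
    using assms abs_square_le_1[of v] by auto
  also have "\<dots> = \<rho>\<^sup>2 + s * x + 2 * sqrt (s * x) * v * \<rho>"
    using assms by (simp add: power2_sum power_mult_distrib algebra_simps)
  finally have "- (\<rho>\<^sup>2 + 2 * (s * x)) \<le> 2 * sqrt (s * x) * v * \<rho> - s * x"
    by linarith
  then have "lam * - (\<rho>\<^sup>2 + 2 * (s * x)) \<le> tilt_exponent lam s \<rho> x v"
    unfolding tilt_exponent_def using assms by (intro mult_left_mono) auto
  then show ?thesis by (simp add: algebra_simps)
qed

text \<open>
  The channel described by the density of the joint law of input, ratio and output with respect to
  \<open>\<mu> \<otimes> \<pi> \<otimes> \<nu>\<close>, instead of by independence and the laws of the noises.
\<close>

locale polar_channel = prob_space M for M :: "'a measure" +
  fixes X G N :: "'a \<Rightarrow> real" and lam :: real and \<pi> \<nu> :: "real measure"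
  assumes lam: "0 < lam"
    and X[measurable]: "X \<in> borel_measurable M" and G[measurable]: "G \<in> borel_measurable M"
    and N[measurable]: "N \<in> borel_measurable M"
    and X_pos: "AE \<omega> in M. 0 < X \<omega>" and G_nonneg: "AE \<omega> in M. 0 \<le> G \<omega>"
    and X_int: "integrable M X" and G_int: "integrable M G" and N_int: "integrable M (\<lambda>\<omega>. (N \<omega>)\<^sup>2)"
    and \<pi>_prob: "prob_space \<pi>" and sets_\<pi>[measurable_cong]: "sets \<pi> = sets borel"
    and \<pi>_support: "AE v in \<pi>. \<bar>v\<bar> \<le> 1" and \<pi>_positive: "0 < emeasure \<pi> {0..}"
    and \<nu>_prob: "prob_space \<nu>" and sets_\<nu>[measurable_cong]: "sets \<nu> = sets borel"
    and \<nu>_pos: "AE z in \<nu>. 0 < z"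
    and channel_law: "\<And>s h. 0 < s \<Longrightarrow> h \<in> borel_measurable (borel \<Otimes>\<^sub>M (borel \<Otimes>\<^sub>M borel)) \<Longrightarrow>
      (\<integral>\<^sup>+\<omega>. h (X \<omega>, (channel_ratio lam X G N s \<omega>, channel_output lam X G N s \<omega>)) \<partial>M) =
      (\<integral>\<^sup>+z. \<integral>\<^sup>+x. \<integral>\<^sup>+v. h (x, (v, z)) * ennreal (exp (tilt_exponent lam s (sqrt z) x v)) \<partial>\<pi> \<partial>distr M borel X \<partial>\<nu>)"
begin

abbreviation "Y \<equiv> channel_Y lam X N"
abbreviation "Z \<equiv> channel_output lam X G N"
abbreviation "V \<equiv> channel_ratio lam X G N"
abbreviation "\<mu> \<equiv> distr M borel X"

interpretation \<pi>: prob_space \<pi> by (rule \<pi>_prob)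
interpretation \<nu>: prob_space \<nu> by (rule \<nu>_prob)
interpretation \<mu>: prob_space \<mu> by (rule prob_space_distr) simp
interpretation \<mu>\<pi>: pair_prob_space \<mu> \<pi> ..
interpretation \<mu>\<nu>: pair_prob_space \<mu> \<nu> ..

lemma YZV_measurable[measurable]:
  "Y s \<in> borel_measurable M" "Z s \<in> borel_measurable M" "V s \<in> borel_measurable M"
  unfolding channel_ratio_def channel_output_def channel_Y_def by measurable

lemma space_\<pi>: "space \<pi> = UNIV" and space_\<nu>: "space \<nu> = UNIV"
  using sets_eq_imp_space_eq[OF sets_\<pi>] sets_eq_imp_space_eq[OF sets_\<nu>] by simp_all

lemma \<mu>_pos: "AE x in \<mu>. 0 < x"
  using X_pos by (subst AE_distr_iff) auto

lemma \<mu>_int: "integrable \<mu> (\<lambda>x. x)"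
  using X_int by (subst integrable_distr_eq) auto

definition likelihood :: "real \<Rightarrow> real \<Rightarrow> real \<Rightarrow> real" where
  "likelihood s x \<rho> = (\<integral>v. exp (tilt_exponent lam s \<rho> x v) \<partial>\<pi>)"

lemma likelihood_measurable[measurable]: "(\<lambda>p. likelihood s (fst p) (snd p)) \<in> borel_measurable (borel \<Otimes>\<^sub>M borel)"
  unfolding likelihood_def tilt_exponent_def by measurable

lemma dirac_prior:
  assumes x: "0 < x"
  shows "amplitude_prior (distr \<pi> (borel \<Otimes>\<^sub>M borel) (Pair x)) lam"
proof -
  interpret D: prob_space "distr \<pi> (borel \<Otimes>\<^sub>M borel) (Pair x)"
    by (rule \<pi>.prob_space_distr) simp
  show ?thesis
  proof
    show "AE t in distr \<pi> (borel \<Otimes>\<^sub>M borel) (Pair x). 0 < fst t \<and> \<bar>snd t\<bar> \<le> 1"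
      using \<pi>_support x by (subst AE_distr_iff) auto
    show "integrable (distr \<pi> (borel \<Otimes>\<^sub>M borel) (Pair x)) fst"
      by (subst integrable_distr_eq) auto
    have "{t \<in> space (borel \<Otimes>\<^sub>M borel). 0 \<le> snd (t :: real \<times> real)} \<in> sets (borel \<Otimes>\<^sub>M borel)"
      by measurable
    then have "{t. 0 \<le> snd (t :: real \<times> real)} \<in> sets (borel \<Otimes>\<^sub>M borel)"
      by (simp add: space_pair_measure)
    then have "emeasure (distr \<pi> (borel \<Otimes>\<^sub>M borel) (Pair x)) {t. 0 \<le> snd t} = emeasure \<pi> {0..}"
      by (subst emeasure_distr) (auto simp: space_\<pi> intro!: arg_cong2[where f=emeasure])
    then show "0 < emeasure (distr \<pi> (borel \<Otimes>\<^sub>M borel) (Pair x)) {t. 0 \<le> snd t}"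
      using \<pi>_positive by simp
  qed (use lam in simp_all)
qed

lemma dirac_integral:
  fixes f :: "real \<times> real \<Rightarrow> real"
  assumes [measurable]: "f \<in> borel_measurable (borel \<Otimes>\<^sub>M borel)"
  shows "(\<integral>t. f t \<partial>distr \<pi> (borel \<Otimes>\<^sub>M borel) (Pair x)) = (\<integral>v. f (x, v) \<partial>\<pi>)"
  by (subst integral_distr) auto

lemma partition_dirac:
  assumes x: "0 < x"
  shows "amplitude_prior.partition (distr \<pi> (borel \<Otimes>\<^sub>M borel) (Pair x)) lam s \<rho> = likelihood s x \<rho>"
proof -
  interpret D: amplitude_prior "distr \<pi> (borel \<Otimes>\<^sub>M borel) (Pair x)" lam
    by (rule dirac_prior[OF x])
  show ?thesis
    unfolding D.partition_def likelihood_def by (subst dirac_integral) (auto simp: tilt_exponent_def)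
qed

lemma likelihood_pos:
  assumes "0 < x" "0 \<le> s"
  shows "0 < likelihood s x \<rho>"
proof -
  interpret D: amplitude_prior "distr \<pi> (borel \<Otimes>\<^sub>M borel) (Pair x)" lam
    by (rule dirac_prior[OF assms(1)])
  show ?thesis using D.partition_pos[OF assms(2)] by (simp add: partition_dirac assms)
qed

lemma integrable_dirac_weight:
  assumes "0 < x" "0 \<le> s" and [measurable]: "f \<in> borel_measurable borel" and f: "integrable \<pi> f"
  shows "integrable \<pi> (\<lambda>v. f v * exp (tilt_exponent lam s \<rho> x v))"
proof -
  interpret D: amplitude_prior "distr \<pi> (borel \<Otimes>\<^sub>M borel) (Pair x)" lam
    by (rule dirac_prior[OF assms(1)])
  have "integrable (distr \<pi> (borel \<Otimes>\<^sub>M borel) (Pair x)) (\<lambda>t. f (snd t))"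
    using f by (subst integrable_distr_eq) auto
  from D.integrable_mult_weight[OF assms(2) this, of \<rho>] show ?thesis
    by (subst (asm) integrable_distr_eq) (auto simp: tilt_exponent_def)
qed

lemma integrable_dirac_tilt:
  assumes "0 < x" "0 \<le> s"
  shows "integrable \<pi> (\<lambda>v. exp (tilt_exponent lam s \<rho> x v))"
proof -
  have "integrable \<pi> (\<lambda>v. 1 * exp (tilt_exponent lam s \<rho> x v))"
    by (rule integrable_dirac_weight[OF assms]) simp_all
  then show ?thesis by (simp only: mult_1)
qed

lemma likelihood_bounds:
  assumes x: "0 < x" and s: "0 \<le> s"
  shows "exp (- (lam * (\<rho>\<^sup>2 + 2 * (s * x)))) \<le> likelihood s x \<rho>" "likelihood s x \<rho> \<le> exp (lam * \<rho>\<^sup>2)"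
proof -
  interpret D: amplitude_prior "distr \<pi> (borel \<Otimes>\<^sub>M borel) (Pair x)" lam
    by (rule dirac_prior[OF x])
  show "likelihood s x \<rho> \<le> exp (lam * \<rho>\<^sup>2)" using D.partition_le[OF s, of \<rho>] unfolding partition_dirac[OF x] .
  have "(\<integral>v. exp (- (lam * (\<rho>\<^sup>2 + 2 * (s * x)))) \<partial>\<pi>) \<le> likelihood s x \<rho>"
    unfolding likelihood_def
  proof (rule integral_mono_AE)
    show "integrable \<pi> (\<lambda>v. exp (tilt_exponent lam s \<rho> x v))"
      by (rule integrable_dirac_tilt[OF x s])
    show "AE v in \<pi>. exp (- (lam * (\<rho>\<^sup>2 + 2 * (s * x)))) \<le> exp (tilt_exponent lam s \<rho> x v)"
      using \<pi>_support
    proof eventually_elim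
      case (elim v)
      then have "- (lam * (\<rho>\<^sup>2 + 2 * (s * x))) \<le> tilt_exponent lam s \<rho> x v"
        using x s lam by (intro tilt_exponent_ge) auto
      then show ?case by (simp only: exp_le_cancel_iff)
    qed
  qed simp
  then show "exp (- (lam * (\<rho>\<^sup>2 + 2 * (s * x)))) \<le> likelihood s x \<rho>"
    unfolding lebesgue_integral_const \<pi>.prob_space by simp
qed

sublocale prior: amplitude_prior "\<mu> \<Otimes>\<^sub>M \<pi>" lam
proof
  show "AE t in \<mu> \<Otimes>\<^sub>M \<pi>. 0 < fst t \<and> \<bar>snd t\<bar> \<le> 1"
  proof (rule \<mu>\<pi>.AE_pair_measure)
    show "AE x in \<mu>. AE v in \<pi>. 0 < fst (x, v) \<and> \<bar>snd (x, v)\<bar> \<le> 1"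
      using \<mu>_pos
    proof eventually_elim
      case (elim x)
      then show ?case using \<pi>_support by simp
    qed
  qed measurable
  show "integrable (\<mu> \<Otimes>\<^sub>M \<pi>) fst"
  proof -
    have "integrable (distr (\<mu> \<Otimes>\<^sub>M \<pi>) \<mu> fst) (\<lambda>x. x)"
      using \<mu>_int by (subst \<pi>.distr_pair_fst) (simp_all add: \<pi>.emeasure_space_1)
    then show ?thesis by (subst (asm) integrable_distr_eq) auto
  qed
  have "{t. 0 \<le> snd t} = (UNIV :: real set) \<times> {0 :: real..}" by auto
  then have "emeasure (\<mu> \<Otimes>\<^sub>M \<pi>) {t. 0 \<le> snd t} = emeasure \<mu> UNIV * emeasure \<pi> {0..}"
    by (simp only:) (rule \<pi>.emeasure_pair_measure_Times, auto)
  then show "0 < emeasure (\<mu> \<Otimes>\<^sub>M \<pi>) {t. 0 \<le> snd t}"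
    using \<pi>_positive \<mu>.emeasure_space_1 by simp
qed (use lam in \<open>simp_all cong: sets_pair_measure_cong add: sets_\<pi>\<close>)

lemma partition_eq:
  assumes "0 \<le> s"
  shows "prior.partition s \<rho> = (\<integral>x. likelihood s x \<rho> \<partial>\<mu>)" and "integrable \<mu> (\<lambda>x. likelihood s x \<rho>)"
  using \<mu>\<pi>.integral_fst'[OF prior.integrable_weight[OF assms, of \<rho>]]
    \<mu>\<pi>.integrable_fst'[OF prior.integrable_weight[OF assms, of \<rho>]]
  by (simp_all only: prior.partition_def likelihood_def fst_conv snd_conv)

lemma joint_amplitude_ratio:
  assumes s: "0 < s"
  shows "joint_density M (\<mu> \<Otimes>\<^sub>M \<pi>) \<nu> (\<lambda>\<omega>. (X \<omega>, V s \<omega>)) (Z s)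
    (\<lambda>(t, z). exp (tilt_exponent lam s (sqrt z) (fst t) (snd t)))"
proof -
  interpret P: pair_sigma_finite "\<mu> \<Otimes>\<^sub>M \<pi>" \<nu> ..
  show ?thesis
  proof
    fix h :: "(real \<times> real) \<times> real \<Rightarrow> ennreal" assume h[measurable]: "h \<in> borel_measurable ((\<mu> \<Otimes>\<^sub>M \<pi>) \<Otimes>\<^sub>M \<nu>)"
    have "sets ((\<mu> \<Otimes>\<^sub>M \<pi>) \<Otimes>\<^sub>M \<nu>) = sets ((borel \<Otimes>\<^sub>M borel) \<Otimes>\<^sub>M borel)"
      by (intro sets_pair_measure_cong sets_\<pi> sets_\<nu> sets_distr)
    then have [measurable]: "h \<in> borel_measurable ((borel \<Otimes>\<^sub>M borel) \<Otimes>\<^sub>M borel)"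
      using h measurable_cong_sets by blast
    show "(\<integral>\<^sup>+\<omega>. h ((X \<omega>, V s \<omega>), Z s \<omega>) \<partial>M) = (\<integral>\<^sup>+z. \<integral>\<^sup>+t. h (t, z) * ennreal (case (t, z) of (t, z) \<Rightarrow> exp (tilt_exponent lam s (sqrt z) (fst t) (snd t))) \<partial>(\<mu> \<Otimes>\<^sub>M \<pi>) \<partial>\<nu>)"
    proof -
      have "(\<integral>\<^sup>+t. h (t, z) * ennreal (exp (tilt_exponent lam s (sqrt z) (fst t) (snd t))) \<partial>(\<mu> \<Otimes>\<^sub>M \<pi>)) =
          (\<integral>\<^sup>+x. \<integral>\<^sup>+v. h ((x, v), z) * ennreal (exp (tilt_exponent lam s (sqrt z) x v)) \<partial>\<pi> \<partial>\<mu>)" for z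
        by (subst \<pi>.nn_integral_fst[symmetric]) (simp_all add: tilt_exponent_def)
      then show ?thesis
        using channel_law[OF s, of "\<lambda>(x, (v, z)). h ((x, v), z)"] by simp
    qed
  next
    show "AE z in \<nu>. integrable (\<mu> \<Otimes>\<^sub>M \<pi>) (\<lambda>t. case (t, z) of (t, z) \<Rightarrow> exp (tilt_exponent lam s (sqrt z) (fst t) (snd t)))"
      using prior.integrable_weight[of s] s by simp
    show "AE z in \<nu>. 0 < (\<integral>t. (case (t, z) of (t, z) \<Rightarrow> exp (tilt_exponent lam s (sqrt z) (fst t) (snd t))) \<partial>(\<mu> \<Otimes>\<^sub>M \<pi>))"
      using prior.partition_pos[of s] s by (simp add: prior.partition_def)
  qed (auto simp: tilt_exponent_def split: prod.split)
qed

lemma joint_ratio: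
  assumes s: "0 < s"
  shows "joint_density M \<pi> (\<mu> \<Otimes>\<^sub>M \<nu>) (V s) (\<lambda>\<omega>. (X \<omega>, Z s \<omega>))
    (\<lambda>(v, p). exp (tilt_exponent lam s (sqrt (snd p)) (fst p) v))"
proof -
  interpret P: pair_sigma_finite \<pi> "\<mu> \<Otimes>\<^sub>M \<nu>" ..
  have pos: "AE p in \<mu> \<Otimes>\<^sub>M \<nu>. 0 < fst p"
  proof (rule \<mu>\<nu>.AE_pair_measure)
    show "{p \<in> space (\<mu> \<Otimes>\<^sub>M \<nu>). 0 < fst p} \<in> sets (\<mu> \<Otimes>\<^sub>M \<nu>)" by measurable
    show "AE x in \<mu>. AE z in \<nu>. 0 < fst (x, z)" using \<mu>_pos by eventually_elim simp
  qed
  show ?thesis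
  proof
    fix h :: "real \<times> (real \<times> real) \<Rightarrow> ennreal" assume h[measurable]: "h \<in> borel_measurable (\<pi> \<Otimes>\<^sub>M (\<mu> \<Otimes>\<^sub>M \<nu>))"
    have "sets (\<pi> \<Otimes>\<^sub>M (\<mu> \<Otimes>\<^sub>M \<nu>)) = sets (borel \<Otimes>\<^sub>M (borel \<Otimes>\<^sub>M borel))"
      by (intro sets_pair_measure_cong sets_\<pi> sets_\<nu> sets_distr)
    then have [measurable]: "h \<in> borel_measurable (borel \<Otimes>\<^sub>M (borel \<Otimes>\<^sub>M borel))"
      using h measurable_cong_sets by blast
    show "(\<integral>\<^sup>+\<omega>. h (V s \<omega>, (X \<omega>, Z s \<omega>)) \<partial>M) = (\<integral>\<^sup>+p. \<integral>\<^sup>+v. h (v, p) * ennreal (case (v, p) of (v, p) \<Rightarrow> exp (tilt_exponent lam s (sqrt (snd p)) (fst p) v)) \<partial>\<pi> \<partial>(\<mu> \<Otimes>\<^sub>M \<nu>))"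
    proof -
      have "(\<integral>\<^sup>+p. \<integral>\<^sup>+v. h (v, p) * ennreal (exp (tilt_exponent lam s (sqrt (snd p)) (fst p) v)) \<partial>\<pi> \<partial>(\<mu> \<Otimes>\<^sub>M \<nu>)) =
          (\<integral>\<^sup>+z. \<integral>\<^sup>+x. \<integral>\<^sup>+v. h (v, (x, z)) * ennreal (exp (tilt_exponent lam s (sqrt z) x v)) \<partial>\<pi> \<partial>\<mu> \<partial>\<nu>)"
        by (subst \<mu>\<nu>.nn_integral_snd[symmetric]) (simp_all add: tilt_exponent_def)
      then show ?thesis
        using channel_law[OF s, of "\<lambda>(x, (v, z)). h (v, (x, z))"] by simp
    qed
  next
    show "AE p in \<mu> \<Otimes>\<^sub>M \<nu>. integrable \<pi> (\<lambda>v. case (v, p) of (v, p) \<Rightarrow> exp (tilt_exponent lam s (sqrt (snd p)) (fst p) v))"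
      using pos
    proof eventually_elim
      case (elim p)
      show ?case unfolding prod.case using elim s by (intro integrable_dirac_tilt) auto
    qed
    show "AE p in \<mu> \<Otimes>\<^sub>M \<nu>. 0 < (\<integral>v. (case (v, p) of (v, p) \<Rightarrow> exp (tilt_exponent lam s (sqrt (snd p)) (fst p) v)) \<partial>\<pi>)"
      using pos
    proof eventually_elim
      case (elim p)
      then show ?case using likelihood_pos[of "fst p" s] s by (simp add: likelihood_def)
    qed
  qed (auto simp: tilt_exponent_def split: prod.split)
qed

lemma joint_input_output:
  assumes s: "0 < s"
  shows "joint_density M \<mu> \<nu> X (Z s) (\<lambda>p. likelihood s (fst p) (sqrt (snd p)))"
proof
  fix h :: "real \<times> real \<Rightarrow> ennreal" assume h[measurable]: "h \<in> borel_measurable (\<mu> \<Otimes>\<^sub>M \<nu>)"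
  have "sets (\<mu> \<Otimes>\<^sub>M \<nu>) = sets (borel \<Otimes>\<^sub>M borel)"
    by (intro sets_pair_measure_cong sets_\<nu> sets_distr)
  then have hm[measurable]: "h \<in> borel_measurable (borel \<Otimes>\<^sub>M borel)"
    using h measurable_cong_sets by blast
  have "(\<integral>\<^sup>+\<omega>. h (X \<omega>, Z s \<omega>) \<partial>M) = (\<integral>\<^sup>+z. \<integral>\<^sup>+x. \<integral>\<^sup>+v. h (x, z) * ennreal (exp (tilt_exponent lam s (sqrt z) x v)) \<partial>\<pi> \<partial>\<mu> \<partial>\<nu>)"
    using channel_law[OF s, of "\<lambda>(x, (v, z)). h (x, z)"] by simp
  also have "\<dots> = (\<integral>\<^sup>+z. \<integral>\<^sup>+x. h (x, z) * ennreal (likelihood s (fst (x, z)) (sqrt (snd (x, z)))) \<partial>\<mu> \<partial>\<nu>)"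
  proof (rule nn_integral_cong, rule nn_integral_cong_AE)
    fix z
    show "AE x in \<mu>. (\<integral>\<^sup>+v. h (x, z) * ennreal (exp (tilt_exponent lam s (sqrt z) x v)) \<partial>\<pi>) = h (x, z) * ennreal (likelihood s (fst (x, z)) (sqrt (snd (x, z))))"
      using \<mu>_pos
    proof eventually_elim
      case (elim x)
      have "(\<integral>\<^sup>+v. ennreal (exp (tilt_exponent lam s (sqrt z) x v)) \<partial>\<pi>) = ennreal (likelihood s x (sqrt z))"
        unfolding likelihood_def using s elim
        by (intro nn_integral_eq_integral integrable_dirac_tilt) auto
      then show ?case by (subst nn_integral_cmult) (auto simp: tilt_exponent_def)
    qed
  qed
  finally show "(\<integral>\<^sup>+\<omega>. h (X \<omega>, Z s \<omega>) \<partial>M) = (\<integral>\<^sup>+z. \<integral>\<^sup>+x. h (x, z) * ennreal (likelihood s (fst (x, z)) (sqrt (snd (x, z)))) \<partial>\<mu> \<partial>\<nu>)" .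
next
  show "AE z in \<nu>. integrable \<mu> (\<lambda>x. likelihood s (fst (x, z)) (sqrt (snd (x, z))))"
    using partition_eq(2)[of s] s by simp
  show "AE z in \<nu>. 0 < (\<integral>x. likelihood s (fst (x, z)) (sqrt (snd (x, z))) \<partial>\<mu>)"
    using partition_eq(1)[of s] prior.partition_pos[of s] s by simp
  show "0 \<le> likelihood s (fst p) (sqrt (snd p))" for p by (simp add: likelihood_def)
qed (auto simp: likelihood_def tilt_exponent_def)

lemma output_pos:
  assumes s: "0 < s"
  shows "AE \<omega> in M. 0 < Z s \<omega>"
proof -
  interpret J: joint_density M \<mu> \<nu> X "Z s" "\<lambda>p. likelihood s (fst p) (sqrt (snd p))"
    by (rule joint_input_output[OF s])
  show ?thesis by (rule J.AE_observation) (use \<nu>_pos in auto)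
qed

text \<open>
  The information density along the trajectory \<open>\<omega>\<close>, as a function of the parameter \<open>s\<close>.
\<close>

definition info :: "real \<Rightarrow> 'a \<Rightarrow> real" where
  "info s \<omega> = ln (likelihood s (X \<omega>) (sqrt (Z s \<omega>))) - ln (prior.partition s (sqrt (Z s \<omega>)))"

lemma partition_measurable[measurable]: "prior.partition s \<in> borel_measurable borel"
  unfolding prior.partition_def tilt_exponent_def by measurable

lemma likelihood_channel_measurable[measurable]: "(\<lambda>\<omega>. likelihood s (X \<omega>) (sqrt (Z s \<omega>))) \<in> borel_measurable M"
proof -
  have "(\<lambda>\<omega>. (\<lambda>p. likelihood s (fst p) (snd p)) (X \<omega>, sqrt (Z s \<omega>))) \<in> borel_measurable M"
    by measurable
  then show ?thesis by simp
qed

lemma info_measurable[measurable]: "info s \<in> borel_measurable M"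
  unfolding info_def by measurable

lemma mutual_information_eq:
  assumes s: "0 < s"
  shows "mutual_information (exp 1) borel borel X (Z s) = expectation (info s)"
proof -
  interpret J: joint_density M \<mu> \<nu> X "Z s" "\<lambda>p. likelihood s (fst p) (sqrt (snd p))"
    by (rule joint_input_output[OF s])
  have "mutual_information (exp 1) borel borel X (Z s) = mutual_information (exp 1) \<mu> \<nu> X (Z s)"
    unfolding mutual_information_def
    by (intro arg_cong2[where f="KL_divergence (exp 1)"] arg_cong2[where f=pair_measure] distr_cong)
       (simp_all add: sets_\<nu> cong: sets_pair_measure_cong)
  also have "\<dots> = expectation (\<lambda>\<omega>. ln (likelihood s (fst (X \<omega>, Z s \<omega>)) (sqrt (snd (X \<omega>, Z s \<omega>))) / J.marginal (Z s \<omega>)))"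
    by (rule J.mutual_information_eq_expectation) (rule distr_cong, simp_all)
  also have "\<dots> = expectation (info s)"
  proof (rule integral_cong_AE)
    show "AE \<omega> in M. ln (likelihood s (fst (X \<omega>, Z s \<omega>)) (sqrt (snd (X \<omega>, Z s \<omega>))) / J.marginal (Z s \<omega>)) = info s \<omega>"
      using X_pos
    proof eventually_elim
      case (elim \<omega>)
      then show ?case
        using likelihood_pos[of "X \<omega>" s "sqrt (Z s \<omega>)"] prior.partition_pos[of s "sqrt (Z s \<omega>)"] s
        by (simp add: J.marginal_def info_def partition_eq(1)[symmetric] ln_div)
    qed
  qed simp_all
  finally show ?thesis .
qed

section \<open>The derivative of the mutual information\<close>

text \<open>
  The posterior means \<open>E[sqrt X V | X = x, sqrt Z = \<rho>]\<close>, \<open>E[sqrt X V | sqrt Z = \<rho>]\<close> and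
  \<open>E[X | sqrt Z = \<rho>]\<close>.
\<close>

definition mean_given_input :: "real \<Rightarrow> real \<Rightarrow> real \<Rightarrow> real" where
  "mean_given_input s x \<rho> = (\<integral>v. sqrt x * v * exp (tilt_exponent lam s \<rho> x v) \<partial>\<pi>) / likelihood s x \<rho>"

definition mean_given_output :: "real \<Rightarrow> real \<Rightarrow> real" where
  "mean_given_output s \<rho> = (\<integral>t. sqrt (fst t) * snd t * prior.weight s \<rho> t \<partial>(\<mu> \<Otimes>\<^sub>M \<pi>)) / prior.partition s \<rho>"

definition input_given_output :: "real \<Rightarrow> real \<Rightarrow> real" where
  "input_given_output s \<rho> = (\<integral>t. fst t * prior.weight s \<rho> t \<partial>(\<mu> \<Otimes>\<^sub>M \<pi>)) / prior.partition s \<rho>"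

definition info_deriv :: "real \<Rightarrow> 'a \<Rightarrow> real" where
  "info_deriv r \<omega> = lam *
    ((sqrt (Z r \<omega>) / sqrt r + sqrt (X \<omega>) * V r \<omega>) *
       (mean_given_input r (X \<omega>) (sqrt (Z r \<omega>)) - mean_given_output r (sqrt (Z r \<omega>)))
     - (X \<omega> - input_given_output r (sqrt (Z r \<omega>))))"

lemma output_radius_lipschitz:
  assumes "0 < X \<omega>" "0 \<le> G \<omega>"
  shows "\<bar>sqrt (Z s \<omega>) - sqrt (Z r \<omega>)\<bar> \<le> sqrt (X \<omega>) * \<bar>sqrt s - sqrt r\<bar>"
proof -
  have "\<bar>sqrt (Z s \<omega>) - sqrt (Z r \<omega>)\<bar> \<le> \<bar>Y s \<omega> - Y r \<omega>\<bar>"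
    unfolding channel_output_def using assms(2) by (rule radius_lipschitz)
  also have "Y s \<omega> - Y r \<omega> = sqrt (X \<omega>) * (sqrt s - sqrt r)"
    by (simp add: channel_Y_def real_sqrt_mult algebra_simps)
  finally show ?thesis using assms by (simp add: abs_mult)
qed

lemma has_derivative_output_radius:
  assumes r: "0 < r" and Z: "0 < Z r \<omega>"
  shows "((\<lambda>s. sqrt (Z s \<omega>)) has_real_derivative (sqrt (X \<omega>) * V r \<omega>) / (2 * sqrt r)) (at r)"
proof -
  have Y: "((\<lambda>s. Y s \<omega>) has_real_derivative sqrt (X \<omega>) / (2 * sqrt r)) (at r)"
    unfolding channel_Y_def real_sqrt_mult using r
    by (auto intro!: derivative_eq_intros DERIV_real_sqrt simp: field_simps)
  have "((\<lambda>s. Z s \<omega>) has_real_derivative 2 * Y r \<omega> * (sqrt (X \<omega>) / (2 * sqrt r))) (at r)"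
    unfolding channel_output_def by (auto intro!: derivative_eq_intros Y)
  from DERIV_chain2[OF DERIV_real_sqrt[OF Z] this]
  have "((\<lambda>s. sqrt (Z s \<omega>)) has_real_derivative inverse (sqrt (Z r \<omega>)) / 2 * (2 * Y r \<omega> * (sqrt (X \<omega>) / (2 * sqrt r)))) (at r)" .
  also have "inverse (sqrt (Z r \<omega>)) / 2 * (2 * Y r \<omega> * (sqrt (X \<omega>) / (2 * sqrt r))) = (sqrt (X \<omega>) * V r \<omega>) / (2 * sqrt r)"
    by (simp add: channel_ratio_def field_simps)
  finally show ?thesis .
qed

text \<open>
  Only the point \<open>r\<close> has to avoid a vanishing output, which it does almost surely.
\<close>

lemma has_derivative_info:
  assumes r: "0 < r" and X: "0 < X \<omega>" and G: "0 \<le> G \<omega>" and Z: "0 < Z r \<omega>"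
  shows "((\<lambda>s. info s \<omega>) has_real_derivative info_deriv r \<omega>) (at r)"
proof -
  interpret D: amplitude_prior "distr \<pi> (borel \<Otimes>\<^sub>M borel) (Pair (X \<omega>))" lam
    by (rule dirac_prior[OF X])
  let ?R = "\<lambda>s. sqrt (Z s \<omega>)" and ?D = "sqrt (X \<omega>) * V r \<omega>"
  have Znn: "0 \<le> ?R s" for s using G by (simp add: channel_output_def)
  have r0: "0 \<le> r" using r by simp
  note lip = output_radius_lipschitz[OF X G, of _ r]
  note dR = has_derivative_output_radius[OF r Z]
  have P: "((\<lambda>s. ln (prior.partition s (?R s))) has_real_derivative
      lam * ((?R r / sqrt r + ?D) * mean_given_output r (?R r) - input_given_output r (?R r))) (at r)"
    using prior.partition_pos[OF r0, of "?R r"] X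
    by (auto intro!: derivative_eq_intros prior.has_derivative_partition[OF r less_imp_le[OF X] Znn lip dR]
      simp: mean_given_output_def input_given_output_def field_simps)
  have mi: "(\<integral>t. sqrt (fst t) * snd t * D.weight r (?R r) t \<partial>distr \<pi> (borel \<Otimes>\<^sub>M borel) (Pair (X \<omega>)))
      = mean_given_input r (X \<omega>) (?R r) * likelihood r (X \<omega>) (?R r)"
    using likelihood_pos[OF X r0, of "?R r"]
    by (subst dirac_integral) (auto simp: mean_given_input_def tilt_exponent_def)
  have ii: "(\<integral>t. fst t * D.weight r (?R r) t \<partial>distr \<pi> (borel \<Otimes>\<^sub>M borel) (Pair (X \<omega>)))
      = X \<omega> * likelihood r (X \<omega>) (?R r)"
    by (subst dirac_integral) (auto simp: likelihood_def tilt_exponent_def)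
  have dK: "((\<lambda>s. likelihood s (X \<omega>) (?R s)) has_real_derivative
      lam * ((?R r / sqrt r + ?D) * (mean_given_input r (X \<omega>) (?R r) * likelihood r (X \<omega>) (?R r)) - X \<omega> * likelihood r (X \<omega>) (?R r))) (at r)"
    using D.has_derivative_partition[OF r less_imp_le[OF X] Znn lip dR]
    unfolding partition_dirac[OF X] mi ii by simp
  have "((\<lambda>s. ln (likelihood s (X \<omega>) (?R s))) has_real_derivative
      lam * ((?R r / sqrt r + ?D) * mean_given_input r (X \<omega>) (?R r) - X \<omega>)) (at r)"
    using likelihood_pos[OF X r0, of "?R r"]
    by (auto intro!: derivative_eq_intros dK simp: field_simps)
  from DERIV_diff[OF this P] show ?thesis
    unfolding info_def info_deriv_def by (rule DERIV_cong) (simp add: algebra_simps)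
qed

lemma output_le:
  assumes "0 < r" "0 < X \<omega>" "0 \<le> s" "s \<le> 2 * r"
  shows "Z s \<omega> \<le> G \<omega> + 4 * r * X \<omega> + (N \<omega>)\<^sup>2 / lam"
proof -
  have "(Y s \<omega>)\<^sup>2 \<le> 2 * (sqrt (s * X \<omega>))\<^sup>2 + 2 * (N \<omega> / sqrt (2 * lam))\<^sup>2"
    unfolding channel_Y_def
    using sum_squares_bound[of "sqrt (s * X \<omega>)" "N \<omega> / sqrt (2 * lam)"] unfolding power2_sum by linarith
  also have "\<dots> = 2 * s * X \<omega> + (N \<omega>)\<^sup>2 / lam"
    using assms lam by (simp add: power_divide)
  also have "2 * s * X \<omega> \<le> 4 * r * X \<omega>"
    using assms by (intro mult_right_mono) auto
  finally show ?thesis by (simp add: channel_output_def)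
qed

text \<open>
  Applied to the Dirac prior, the posterior mean in the Lipschitz constant is the input itself;
  applied to the law of the input, it is affine in the output, which is bounded uniformly in
  \<open>s \<le> 2 r\<close> by a linear combination of \<open>X\<close>, \<open>G\<close> and \<open>N\<^sup>2\<close>.
\<close>

lemma info_lipschitz:
  assumes r: "0 < r"
  obtains D where "integrable M D"
    "\<And>s. \<bar>s - r\<bar> < r / 2 \<Longrightarrow> AE \<omega> in M. \<bar>info s \<omega> - info r \<omega>\<bar> \<le> \<bar>s - r\<bar> * D \<omega>"
proof -
  obtain A B where AB: "0 \<le> A" "0 \<le> B"
    "\<And>s \<rho>. r / 2 \<le> s \<Longrightarrow> s \<le> 2 * r \<Longrightarrow> 0 \<le> \<rho> \<Longrightarrow>
      (\<integral>t. fst t * prior.weight s \<rho> t \<partial>(\<mu> \<Otimes>\<^sub>M \<pi>)) \<le> (A + B * \<rho>\<^sup>2) * prior.partition s \<rho>"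
    using prior.posterior_mean_bound[OF r] by blast
  define Q where "Q \<omega> = G \<omega> + 4 * r * X \<omega> + (N \<omega>)\<^sup>2 / lam" for \<omega>
  show ?thesis
  proof (rule that)
    show "integrable M (\<lambda>\<omega>. lam * (2 * X \<omega> + 2 * Q \<omega> / r + 4 * X \<omega>) + lam * (2 * (A + B * Q \<omega>) + 2 * Q \<omega> / r + 4 * X \<omega>))"
      unfolding Q_def using X_int G_int N_int by simp
    fix s assume "\<bar>s - r\<bar> < r / 2"
    then have s: "r / 2 \<le> s" "s \<le> 2 * r" "0 \<le> s" and r': "r / 2 \<le> r" "r \<le> 2 * r" "0 \<le> r"
      using r by linarith+
    show "AE \<omega> in M. \<bar>info s \<omega> - info r \<omega>\<bar> \<le> \<bar>s - r\<bar> *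
        (lam * (2 * X \<omega> + 2 * Q \<omega> / r + 4 * X \<omega>) + lam * (2 * (A + B * Q \<omega>) + 2 * Q \<omega> / r + 4 * X \<omega>))"
      using X_pos G_nonneg
    proof eventually_elim
      case (elim \<omega>)
      interpret D: amplitude_prior "distr \<pi> (borel \<Otimes>\<^sub>M borel) (Pair (X \<omega>))" lam
        by (rule dirac_prior[OF elim(1)])
      let ?R = "\<lambda>s. sqrt (Z s \<omega>)"
      have Znn: "0 \<le> Z s \<omega>" for s using elim by (simp add: channel_output_def)
      then have R: "0 \<le> ?R s" for s by simp
      have RQ: "(?R s)\<^sup>2 \<le> Q \<omega>" "(?R r)\<^sup>2 \<le> Q \<omega>"
        using output_le[OF r elim(1) s(3,2)] output_le[OF r elim(1) r'(3,2)] Znn by (simp_all add: Q_def)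
      note lip = output_radius_lipschitz[OF elim, of s r]
      have "(\<integral>t. fst t * D.weight s \<rho> t \<partial>distr \<pi> (borel \<Otimes>\<^sub>M borel) (Pair (X \<omega>)))
          = X \<omega> * likelihood s (X \<omega>) \<rho>" for s \<rho>
        by (subst dirac_integral) (auto simp: likelihood_def tilt_exponent_def)
      then have 1: "\<bar>ln (likelihood s (X \<omega>) (?R s)) - ln (likelihood r (X \<omega>) (?R r))\<bar> \<le>
          \<bar>s - r\<bar> * (lam * (2 * X \<omega> + 2 * Q \<omega> / r + 4 * X \<omega>))"
        using D.abs_ln_partition_diff_le[OF r s(1,2) r'(1,2) less_imp_le[OF elim(1)] R RQ(1) R RQ(2) lip, of "X \<omega>"]
        unfolding partition_dirac[OF elim(1)] by simp
      have mono: "(A + B * (?R u)\<^sup>2) * prior.partition u (?R u) \<le> (A + B * Q \<omega>) * prior.partition u (?R u)"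
        if "0 \<le> u" "(?R u)\<^sup>2 \<le> Q \<omega>" for u
        using that AB prior.partition_pos[OF that(1), of "?R u"]
        by (intro mult_right_mono add_left_mono mult_left_mono) auto
      have 2: "\<bar>ln (prior.partition s (?R s)) - ln (prior.partition r (?R r))\<bar> \<le>
          \<bar>s - r\<bar> * (lam * (2 * (A + B * Q \<omega>) + 2 * Q \<omega> / r + 4 * X \<omega>))"
        by (rule prior.abs_ln_partition_diff_le[OF r s(1,2) r'(1,2) less_imp_le[OF elim(1)] R RQ(1) R RQ(2) lip])
           (rule order_trans[OF AB(3)[OF s(1,2) R] mono[OF s(3) RQ(1)]], rule order_trans[OF AB(3)[OF r'(1,2) R] mono[OF r'(3) RQ(2)]])
      have "\<bar>info s \<omega> - info r \<omega>\<bar> \<le> \<bar>ln (likelihood s (X \<omega>) (?R s)) - ln (likelihood r (X \<omega>) (?R r))\<bar>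
          + \<bar>ln (prior.partition s (?R s)) - ln (prior.partition r (?R r))\<bar>"
        unfolding info_def by linarith
      with 1 2 show ?case by (subst distrib_left) linarith
    qed
  qed
qed

lemma output_integrable:
  assumes "0 < s"
  shows "integrable M (Z s)"
proof (rule Bochner_Integration.integrable_bound)
  show "integrable M (\<lambda>\<omega>. G \<omega> + 4 * s * X \<omega> + (N \<omega>)\<^sup>2 / lam)"
    using X_int G_int N_int by simp
  show "AE \<omega> in M. norm (Z s \<omega>) \<le> norm (G \<omega> + 4 * s * X \<omega> + (N \<omega>)\<^sup>2 / lam)"
    using X_pos G_nonneg
  proof eventually_elim
    case (elim \<omega>)
    have "0 \<le> Z s \<omega>" using elim by (simp add: channel_output_def)
    then show ?case using output_le[OF assms elim(1), of s] assms by simp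
  qed
qed measurable

text \<open>
  The two logarithms are integrable separately: from above by \<open>lam Z\<close>, from below by the uniform
  lower bound on the partition function of the prior and by \<open>tilt_exponent_ge\<close> for a given input.
\<close>

lemma info_integrable:
  assumes s: "0 < s"
  shows "integrable M (info s)"
proof -
  obtain c where c: "0 < c" "\<And>u \<rho>. 0 \<le> u \<Longrightarrow> u \<le> 2 * s \<Longrightarrow> 0 \<le> \<rho> \<Longrightarrow> c \<le> prior.partition u \<rho>"
    using prior.partition_lower_bound[OF s] by blast
  show ?thesis
  proof (rule Bochner_Integration.integrable_bound)
    show "integrable M (\<lambda>\<omega>. lam * (Z s \<omega> + 2 * (s * X \<omega>)) + (lam * Z s \<omega> + \<bar>ln c\<bar>))"
      using output_integrable[OF s] X_int by simp
    show "AE \<omega> in M. norm (info s \<omega>) \<le> norm (lam * (Z s \<omega> + 2 * (s * X \<omega>)) + (lam * Z s \<omega> + \<bar>ln c\<bar>))"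
      using X_pos output_pos[OF s]
    proof eventually_elim
      case (elim \<omega>)
      let ?\<rho> = "sqrt (Z s \<omega>)"
      have s0: "0 \<le> s" using s by simp
      have \<rho>: "?\<rho>\<^sup>2 = Z s \<omega>" "0 \<le> ?\<rho>" using elim by auto
      have K: "- (lam * (Z s \<omega> + 2 * (s * X \<omega>))) \<le> ln (likelihood s (X \<omega>) ?\<rho>)" "ln (likelihood s (X \<omega>) ?\<rho>) \<le> lam * Z s \<omega>"
        using ln_mono[OF likelihood_bounds(1)[OF elim(1) s0, of ?\<rho>]] ln_mono[OF likelihood_bounds(2)[OF elim(1) s0, of ?\<rho>]]
          likelihood_pos[OF elim(1) s0, of ?\<rho>] \<rho> by auto
      have P: "ln c \<le> ln (prior.partition s ?\<rho>)" "ln (prior.partition s ?\<rho>) \<le> lam * Z s \<omega>"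
        using ln_mono[OF c(2)[of s ?\<rho>]] ln_mono[OF prior.partition_le[OF s0, of ?\<rho>]]
          prior.partition_pos[OF s0, of ?\<rho>] c(1) s \<rho> by auto
      have "0 \<le> lam * (2 * (s * X \<omega>))" "0 \<le> lam * Z s \<omega>" using elim s lam by auto
      with K P show ?case unfolding info_def real_norm_def distrib_left by linarith
    qed
  qed measurable
qed

lemma mean_measurable[measurable]:
  "mean_given_output s \<in> borel_measurable borel" "input_given_output s \<in> borel_measurable borel"
  unfolding mean_given_output_def input_given_output_def tilt_exponent_def by measurable

lemma mean_given_input_measurable[measurable]:
  "(\<lambda>\<omega>. mean_given_input s (X \<omega>) (sqrt (Z s \<omega>))) \<in> borel_measurable M"
proof -
  have "(\<lambda>p. mean_given_input s (fst p) (snd p)) \<in> borel_measurable (borel \<Otimes>\<^sub>M borel)"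
    unfolding mean_given_input_def tilt_exponent_def by measurable
  then have "(\<lambda>\<omega>. (\<lambda>p. mean_given_input s (fst p) (snd p)) (X \<omega>, sqrt (Z s \<omega>))) \<in> borel_measurable M"
    by measurable
  then show ?thesis by simp
qed

lemma info_deriv_measurable[measurable]: "info_deriv r \<in> borel_measurable M"
  unfolding info_deriv_def by measurable

lemma
  assumes r: "0 < r"
  shows info_deriv_integrable: "integrable M (info_deriv r)"
    and has_derivative_mutual_information:
      "((\<lambda>s. mutual_information (exp 1) borel borel X (Z s)) has_real_derivative expectation (info_deriv r)) (at r)"
proof -
  obtain D where D: "integrable M D"
    "\<And>s. \<bar>s - r\<bar> < r / 2 \<Longrightarrow> AE \<omega> in M. \<bar>info s \<omega> - info r \<omega>\<bar> \<le> \<bar>s - r\<bar> * D \<omega>"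
    using info_lipschitz[OF r] by blast
  have int: "integrable M (info s)" if "\<bar>s - r\<bar> < r / 2" for s
    using that r by (intro info_integrable) linarith
  have deriv: "AE \<omega> in M. ((\<lambda>s. info s \<omega>) has_real_derivative info_deriv r \<omega>) (at r)"
    using X_pos G_nonneg output_pos[OF r] by eventually_elim (rule has_derivative_info[OF r])
  have r2: "0 < r / 2" using r by simp
  show "integrable M (info_deriv r)"
    by (rule integrable_derivative_lipschitz[OF r2 int D(1) info_deriv_measurable deriv D(2)])
  have "((\<lambda>s. expectation (info s)) has_real_derivative expectation (info_deriv r)) (at r)"
    by (rule has_real_derivative_integral_lipschitz[OF r2 int D(1) info_deriv_measurable deriv D(2)])
  then show "((\<lambda>s. mutual_information (exp 1) borel borel X (Z s)) has_real_derivative expectation (info_deriv r)) (at r)"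
    by (rule has_field_derivative_transform_within_open[where S="{0<..}"])
       (use r mutual_information_eq in auto)
qed

lemma abs_ratio_le: "0 \<le> G \<omega> \<Longrightarrow> \<bar>V s \<omega>\<bar> \<le> 1"
proof -
  assume "0 \<le> G \<omega>"
  then have le: "\<bar>Y s \<omega>\<bar> \<le> sqrt (Z s \<omega>)"
    unfolding channel_output_def by (intro real_le_rsqrt) simp
  show ?thesis
  proof (cases "sqrt (Z s \<omega>) = 0")
    case False
    with le have "0 < sqrt (Z s \<omega>)" by linarith
    with le show ?thesis by (simp add: channel_ratio_def abs_divide)
  qed (simp add: channel_ratio_def)
qed

lemma abs_mean_given_input_le:
  assumes x: "0 < x" and s: "0 \<le> s"
  shows "\<bar>mean_given_input s x \<rho>\<bar> \<le> sqrt x"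
proof -
  have w: "integrable \<pi> (\<lambda>v. exp (tilt_exponent lam s \<rho> x v))"
    by (rule integrable_dirac_tilt[OF x s])
  have "\<bar>\<integral>v. sqrt x * v * exp (tilt_exponent lam s \<rho> x v) \<partial>\<pi>\<bar> \<le>
      (\<integral>v. \<bar>sqrt x * v * exp (tilt_exponent lam s \<rho> x v)\<bar> \<partial>\<pi>)"
    by (rule integral_abs_bound)
  also have "\<dots> \<le> (\<integral>v. sqrt x * exp (tilt_exponent lam s \<rho> x v) \<partial>\<pi>)"
  proof (rule integral_mono_AE')
    show "integrable \<pi> (\<lambda>v. sqrt x * exp (tilt_exponent lam s \<rho> x v))"
      using w by simp
    show "AE v in \<pi>. \<bar>sqrt x * v * exp (tilt_exponent lam s \<rho> x v)\<bar> \<le> sqrt x * exp (tilt_exponent lam s \<rho> x v)"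
      using \<pi>_support
    proof eventually_elim
      case (elim v)
      have "\<bar>v\<bar> * (sqrt x * exp (tilt_exponent lam s \<rho> x v)) \<le> 1 * (sqrt x * exp (tilt_exponent lam s \<rho> x v))"
        using elim x by (intro mult_right_mono) auto
      then show ?case using x by (simp add: abs_mult mult_ac)
    qed
  qed (use x in simp)
  also have "\<dots> = sqrt x * likelihood s x \<rho>" by (simp add: likelihood_def)
  finally show ?thesis
    using likelihood_pos[OF x s, of \<rho>] by (simp add: mean_given_input_def abs_divide pos_divide_le_eq)
qed

text \<open>
  With \<open>a = R / sqrt r\<close>, \<open>b = sqrt X V\<close>, \<open>u = E[b | X, Z]\<close>, \<open>w = E[b | Z]\<close> and \<open>q = E[X | Z]\<close> the
  derivative is \<open>lam ((a + b) (u - w) - (X - q))\<close>.  By the tower property \<open>E[a u] = E[a b] = E[a w]\<close>,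
  \<open>E[q] = E[X]\<close> and \<open>E[b w] = E[w\<^sup>2]\<close>, so that \<open>lam (E[b u] - E[w\<^sup>2])\<close> remains.
\<close>

lemma info_deriv_le:
  assumes r: "0 < r"
  shows "expectation (info_deriv r) \<le> lam * (expectation X -
    expectation (\<lambda>\<omega>. (real_cond_exp M (vimage_algebra (space M) (Z r) borel) (\<lambda>\<omega>. sqrt (X \<omega>) * V r \<omega>) \<omega>)\<^sup>2))"
proof -
  interpret J: joint_density M "\<mu> \<Otimes>\<^sub>M \<pi>" \<nu> "\<lambda>\<omega>. (X \<omega>, V r \<omega>)" "Z r"
    "\<lambda>(t, z). exp (tilt_exponent lam r (sqrt z) (fst t) (snd t))"
    by (rule joint_amplitude_ratio[OF r])
  interpret J': joint_density M \<pi> "\<mu> \<Otimes>\<^sub>M \<nu>" "V r" "\<lambda>\<omega>. (X \<omega>, Z r \<omega>)"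
    "\<lambda>(v, p). exp (tilt_exponent lam r (sqrt (snd p)) (fst p) v)"
    by (rule joint_ratio[OF r])
  let ?a = "\<lambda>\<omega>. sqrt (Z r \<omega>) / sqrt r" and ?b = "\<lambda>\<omega>. sqrt (X \<omega>) * V r \<omega>"
  let ?w = "\<lambda>\<omega>. mean_given_output r (sqrt (Z r \<omega>))" and ?u = "\<lambda>\<omega>. mean_given_input r (X \<omega>) (sqrt (Z r \<omega>))"
  let ?q = "\<lambda>\<omega>. input_given_output r (sqrt (Z r \<omega>))"
  have marg: "J.marginal z = prior.partition r (sqrt z)" for z
    by (simp add: J.marginal_def prior.partition_def)
  have marg': "J'.marginal p = likelihood r (fst p) (sqrt (snd p))" for p
    by (simp add: J'.marginal_def likelihood_def)
  have post_w: "J.posterior (\<lambda>(t, z). f z * (sqrt (fst t) * snd t)) z = f z * mean_given_output r (sqrt z)" for f z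
    unfolding J.posterior_def marg mean_given_output_def by (simp add: mult.assoc)
  have post_q: "J.posterior (\<lambda>(t, z). fst t) z = input_given_output r (sqrt z)" for z
    unfolding J.posterior_def marg input_given_output_def by simp
  have post_u: "J'.posterior (\<lambda>(v, p). f p * (sqrt (fst p) * v)) p = f p * mean_given_input r (fst p) (sqrt (snd p))" for f p
    unfolding J'.posterior_def marg' mean_given_input_def by (simp add: mult.assoc)
  have b_le: "AE \<omega> in M. \<bar>?b \<omega>\<bar> \<le> sqrt (X \<omega>)"
    using X_pos G_nonneg
  proof eventually_elim
    case (elim \<omega>)
    have "sqrt (X \<omega>) * \<bar>V r \<omega>\<bar> \<le> sqrt (X \<omega>) * 1"
      using elim abs_ratio_le by (intro mult_left_mono) auto
    then show ?case using elim by (simp add: abs_mult)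
  qed
  have b_int: "integrable M ?b"
  proof (rule Bochner_Integration.integrable_bound)
    show "integrable M (\<lambda>\<omega>. 1 + X \<omega>)" using X_int by simp
    show "AE \<omega> in M. norm (?b \<omega>) \<le> norm (1 + X \<omega>)"
      using b_le X_pos
    proof eventually_elim
      case (elim \<omega>)
      then show ?case using sum_squares_bound[of "sqrt (X \<omega>)" 1] by simp
    qed
  qed measurable
  have ab_int: "integrable M (\<lambda>\<omega>. ?a \<omega> * ?b \<omega>)"
  proof (rule Bochner_Integration.integrable_bound)
    show "integrable M (\<lambda>\<omega>. Z r \<omega> / r + X \<omega>)" using X_int output_integrable[OF r] by simp
    show "AE \<omega> in M. norm (?a \<omega> * ?b \<omega>) \<le> norm (Z r \<omega> / r + X \<omega>)"
      using b_le X_pos output_pos[OF r]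
    proof eventually_elim
      case (elim \<omega>)
      have a0: "0 \<le> ?a \<omega>" using elim r by simp
      have "\<bar>?a \<omega> * ?b \<omega>\<bar> = ?a \<omega> * \<bar>?b \<omega>\<bar>" using a0 by (simp only: abs_mult abs_of_nonneg)
      also have "\<dots> \<le> ?a \<omega> * sqrt (X \<omega>)" using elim(1) a0 by (rule mult_left_mono)
      also have "\<dots> \<le> (?a \<omega>)\<^sup>2 + (sqrt (X \<omega>))\<^sup>2"
        using sum_squares_bound[of "?a \<omega>" "sqrt (X \<omega>)"] mult_nonneg_nonneg[OF a0 real_sqrt_ge_zero[OF less_imp_le[OF elim(2)]]] by linarith
      also have "\<dots> = Z r \<omega> / r + X \<omega>" using elim r by (simp add: power_divide)
      finally show ?case by simp
    qed
  qed measurable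
  have aw: "integrable M (\<lambda>\<omega>. ?a \<omega> * ?w \<omega>)" "expectation (\<lambda>\<omega>. ?a \<omega> * ?w \<omega>) = expectation (\<lambda>\<omega>. ?a \<omega> * ?b \<omega>)"
    using J.integrable_posterior[of "\<lambda>(t, z). sqrt z / sqrt r * (sqrt (fst t) * snd t)"]
      J.expectation_posterior[of "\<lambda>(t, z). sqrt z / sqrt r * (sqrt (fst t) * snd t)"] ab_int
    unfolding post_w by simp_all
  have au: "integrable M (\<lambda>\<omega>. ?a \<omega> * ?u \<omega>)" "expectation (\<lambda>\<omega>. ?a \<omega> * ?u \<omega>) = expectation (\<lambda>\<omega>. ?a \<omega> * ?b \<omega>)"
    using J'.integrable_posterior[of "\<lambda>(v, p). sqrt (snd p) / sqrt r * (sqrt (fst p) * v)"]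
      J'.expectation_posterior[of "\<lambda>(v, p). sqrt (snd p) / sqrt r * (sqrt (fst p) * v)"] ab_int
    unfolding post_u by simp_all
  have q: "integrable M ?q" "expectation ?q = expectation X"
    using J.integrable_posterior[of "\<lambda>(t, z). fst t"] J.expectation_posterior[of "\<lambda>(t, z). fst t"] X_int
    unfolding post_q by simp_all
  have bu_le: "AE \<omega> in M. \<bar>?b \<omega> * ?u \<omega>\<bar> \<le> X \<omega>"
    using b_le X_pos
  proof eventually_elim
    case (elim \<omega>)
    have "\<bar>?b \<omega> * ?u \<omega>\<bar> \<le> sqrt (X \<omega>) * sqrt (X \<omega>)"
      unfolding abs_mult[of "?b \<omega>" "?u \<omega>"]
      using elim abs_mean_given_input_le[OF elim(2) less_imp_le[OF r], of "sqrt (Z r \<omega>)"] by (intro mult_mono) auto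
    then show ?case using elim by simp
  qed
  have bu: "integrable M (\<lambda>\<omega>. ?b \<omega> * ?u \<omega>)"
  proof (rule Bochner_Integration.integrable_bound[OF X_int])
    show "AE \<omega> in M. norm (?b \<omega> * ?u \<omega>) \<le> norm (X \<omega>)"
      using bu_le by eventually_elim simp
  qed measurable
  have bu_exp: "expectation (\<lambda>\<omega>. ?b \<omega> * ?u \<omega>) \<le> expectation X"
    by (rule integral_mono_AE[OF bu X_int]) (use bu_le in \<open>eventually_elim, simp\<close>)
  \<comment> \<open>integrability of \<open>b w\<close> is not clear beforehand: it is inherited from the derivative\<close>
  have bw_eq: "?b \<omega> * ?w \<omega> = ?a \<omega> * ?u \<omega> - ?a \<omega> * ?w \<omega> + ?b \<omega> * ?u \<omega> - X \<omega> + ?q \<omega> - info_deriv r \<omega> / lam" for \<omega>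
  proof -
    have "info_deriv r \<omega> / lam = (?a \<omega> + ?b \<omega>) * (?u \<omega> - ?w \<omega>) - (X \<omega> - ?q \<omega>)"
      unfolding info_deriv_def using lam by simp
    then show ?thesis by (simp add: algebra_simps)
  qed
  have bw_int: "integrable M (\<lambda>\<omega>. ?b \<omega> * ?w \<omega>)"
    unfolding bw_eq using aw au q bu X_int info_deriv_integrable[OF r] by simp
  have bw: "expectation (\<lambda>\<omega>. ?b \<omega> * ?w \<omega>) = expectation (\<lambda>\<omega>. (?w \<omega>)\<^sup>2)"
    using J.expectation_posterior[of "\<lambda>(t, z). mean_given_output r (sqrt z) * (sqrt (fst t) * snd t)"] bw_int
    unfolding post_w by (simp add: power2_eq_square mult_ac)
  have "expectation (\<lambda>\<omega>. ?b \<omega> * ?w \<omega>) = expectation (\<lambda>\<omega>. ?b \<omega> * ?u \<omega>) - expectation (info_deriv r) / lam"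
    unfolding bw_eq using aw au q bu X_int info_deriv_integrable[OF r] by auto
  then have "expectation (info_deriv r) = lam * (expectation (\<lambda>\<omega>. ?b \<omega> * ?u \<omega>) - expectation (\<lambda>\<omega>. (?w \<omega>)\<^sup>2))"
    using lam bw by (simp add: field_simps)
  also have "\<dots> \<le> lam * (expectation X - expectation (\<lambda>\<omega>. (?w \<omega>)\<^sup>2))"
    using bu_exp lam by (intro mult_left_mono) auto
  also have "expectation (\<lambda>\<omega>. (?w \<omega>)\<^sup>2) =
      expectation (\<lambda>\<omega>. (real_cond_exp M (vimage_algebra (space M) (Z r) borel) ?b \<omega>)\<^sup>2)"
  proof (rule integral_cong_AE)
    have F: "vimage_algebra (space M) (Z r) \<nu> = vimage_algebra (space M) (Z r) borel"
      by (simp add: vimage_algebra_def sets_\<nu>)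
    have "AE \<omega> in M. real_cond_exp M (vimage_algebra (space M) (Z r) \<nu>) ?b \<omega> = 1 * ?w \<omega>"
      using J.real_cond_exp_posterior[of "\<lambda>(t, z). 1 * (sqrt (fst t) * snd t)"] b_int unfolding post_w by simp
    then show "AE \<omega> in M. (?w \<omega>)\<^sup>2 = (real_cond_exp M (vimage_algebra (space M) (Z r) borel) ?b \<omega>)\<^sup>2"
      unfolding F by eventually_elim simp
  qed measurable
  finally show ?thesis .
qed

end

section \<open>The joint law of input, ratio and output\<close>

lemma (in prob_space) distr_pair_indep_var:
  assumes ind: "indep_var S A T B"
    and f[measurable]: "f \<in> measurable S S'" and g[measurable]: "g \<in> measurable T T'"
  shows "distr M S' (\<lambda>\<omega>. f (A \<omega>)) \<Otimes>\<^sub>M distr M T' (\<lambda>\<omega>. g (B \<omega>)) =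
    distr M (S' \<Otimes>\<^sub>M T') (\<lambda>\<omega>. (f (A \<omega>), g (B \<omega>)))"
proof -
  have [measurable]: "A \<in> measurable M S" "B \<in> measurable M T"
    and AB: "distr M S A \<Otimes>\<^sub>M distr M T B = distr M (S \<Otimes>\<^sub>M T) (\<lambda>\<omega>. (A \<omega>, B \<omega>))"
    using ind unfolding indep_var_distribution_eq by auto
  interpret gB: prob_space "distr M T' (\<lambda>\<omega>. g (B \<omega>))" by (rule prob_space_distr) simp
  have fA: "distr M S' (\<lambda>\<omega>. f (A \<omega>)) = distr (distr M S A) S' f"
    and gB: "distr M T' (\<lambda>\<omega>. g (B \<omega>)) = distr (distr M T B) T' g"
    by (simp_all add: distr_distr comp_def)
  have "distr M S' (\<lambda>\<omega>. f (A \<omega>)) \<Otimes>\<^sub>M distr M T' (\<lambda>\<omega>. g (B \<omega>)) =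
      distr (distr M S A \<Otimes>\<^sub>M distr M T B) (S' \<Otimes>\<^sub>M T') (\<lambda>(x, y). (f x, g y))"
    unfolding fA gB
    by (rule pair_measure_distr) (simp_all add: gB[symmetric] gB.sigma_finite_measure_axioms)
  also have "\<dots> = distr M (S' \<Otimes>\<^sub>M T') (\<lambda>\<omega>. (f (A \<omega>), g (B \<omega>)))"
    unfolding AB by (subst distr_distr) (simp_all add: comp_def)
  finally show ?thesis .
qed

text \<open>
  Completing the square in the Gaussian density shifts \<open>Y\<close> back to the noise of a zero input, at
  the price of the tilting factor; the polar decomposition then applies to the noise.
\<close>

lemma (in prob_space) channel_joint_law:
  fixes X G N :: "'a \<Rightarrow> real"
  assumes lam: "0 < lam" and s: "0 < s"
    and ind: "indep_vars (\<lambda>_. borel) (\<lambda>i. [X, G, N] ! i) {0, 1, 2 :: nat}"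
    and X_pos: "AE \<omega> in M. 0 < X \<omega>"
    and N: "distributed M lborel N std_normal_density"
    and \<pi>: "prob_space \<pi>" "sets \<pi> = sets borel"
    and \<nu>: "prob_space \<nu>" "sets \<nu> = sets borel" "AE z in \<nu>. 0 < z"
    and polar: "\<And>h. h \<in> borel_measurable (borel \<Otimes>\<^sub>M borel) \<Longrightarrow>
      (\<integral>\<^sup>+g. \<integral>\<^sup>+y. h (y, g + y\<^sup>2) * ennreal (normal_density 0 (1 / sqrt (2 * lam)) y) \<partial>lborel \<partial>distr M borel G) =
      (\<integral>\<^sup>+z. \<integral>\<^sup>+v. h (v * sqrt z, z) \<partial>\<pi> \<partial>\<nu>)"
    and h[measurable]: "h \<in> borel_measurable (borel \<Otimes>\<^sub>M (borel \<Otimes>\<^sub>M borel))"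
  shows "(\<integral>\<^sup>+\<omega>. h (X \<omega>, (channel_ratio lam X G N s \<omega>, channel_output lam X G N s \<omega>)) \<partial>M) =
    (\<integral>\<^sup>+z. \<integral>\<^sup>+x. \<integral>\<^sup>+v. h (x, (v, z)) * ennreal (exp (tilt_exponent lam s (sqrt z) x v)) \<partial>\<pi> \<partial>distr M borel X \<partial>\<nu>)"
proof -
  let ?\<sigma> = "1 / sqrt (2 * lam)"
  let ?\<phi> = "normal_density 0 ?\<sigma>"
  define N0 where "N0 \<omega> = N \<omega> / sqrt (2 * lam)" for \<omega>
  have \<sigma>: "0 < ?\<sigma>" using lam by simp
  have "distributed M lborel (\<lambda>\<omega>. (N0 \<omega> - 0) / ?\<sigma>) std_normal_density"
    using N lam by (simp add: N0_def)
  then have N0: "distributed M lborel N0 ?\<phi>"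
    using normal_standard_normal_convert[OF \<sigma>, of N0 0] by simp
  have "indep_var (PiM {0} (\<lambda>_. borel)) (\<lambda>\<omega>. restrict (\<lambda>i. ([X, G, N] ! i) \<omega>) {0})
      (PiM {1, 2} (\<lambda>_. borel)) (\<lambda>\<omega>. restrict (\<lambda>i. ([X, G, N] ! i) \<omega>) {1, 2})"
    by (rule indep_var_restrict[OF ind]) auto
  from distr_pair_indep_var[OF this, of "\<lambda>f. f 0" borel "\<lambda>f. (f 1, f 2 / sqrt (2 * lam))" "borel \<Otimes>\<^sub>M borel"]
  have X_GN: "distr M borel X \<Otimes>\<^sub>M distr M (borel \<Otimes>\<^sub>M borel) (\<lambda>\<omega>. (G \<omega>, N0 \<omega>)) =
      distr M (borel \<Otimes>\<^sub>M (borel \<Otimes>\<^sub>M borel)) (\<lambda>\<omega>. (X \<omega>, (G \<omega>, N0 \<omega>)))"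
    by (simp add: N0_def)
  have "indep_var (PiM {1} (\<lambda>_. borel)) (\<lambda>\<omega>. restrict (\<lambda>i. ([X, G, N] ! i) \<omega>) {1})
      (PiM {2} (\<lambda>_. borel)) (\<lambda>\<omega>. restrict (\<lambda>i. ([X, G, N] ! i) \<omega>) {2})"
    by (rule indep_var_restrict[OF ind]) auto
  from distr_pair_indep_var[OF this, of "\<lambda>f. f 1" borel "\<lambda>f. f 2 / sqrt (2 * lam)" borel]
  have G_N: "distr M borel G \<Otimes>\<^sub>M distr M borel N0 = distr M (borel \<Otimes>\<^sub>M borel) (\<lambda>\<omega>. (G \<omega>, N0 \<omega>))"
    by (simp add: N0_def[abs_def])
  have rv: "([X, G, N] ! i) \<in> borel_measurable M" if "i \<in> {0, 1, 2 :: nat}" for i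
    using ind that unfolding indep_vars_def by blast
  have [measurable]: "X \<in> borel_measurable M" "G \<in> borel_measurable M" "N \<in> borel_measurable M"
    using rv[of 0] rv[of 1] rv[of 2] by simp_all
  have [measurable]: "N0 \<in> borel_measurable M"
    unfolding N0_def by measurable
  let ?\<mu> = "distr M borel X" and ?\<gamma> = "distr M borel G" and ?n = "density lborel (\<lambda>y. ennreal (?\<phi> y))"
  have n: "distr M borel N0 = ?n"
    using distributed_distr_eq_density[OF N0] by (simp cong: distr_cong)
  interpret \<mu>: prob_space ?\<mu> by (rule prob_space_distr) simp
  interpret \<gamma>: prob_space ?\<gamma> by (rule prob_space_distr) simp
  interpret n: prob_space ?n using \<sigma> by (rule prob_space_normal_density)
  interpret \<pi>: prob_space \<pi> by (rule \<pi>(1))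
  interpret \<nu>: prob_space \<nu> by (rule \<nu>(1))
  interpret \<gamma>n: pair_prob_space ?\<gamma> ?n ..
  interpret \<mu>\<nu>: pair_prob_space ?\<mu> \<nu> ..
  note [measurable_cong] = \<pi>(2) \<nu>(2)
  have joint: "distr M (borel \<Otimes>\<^sub>M (borel \<Otimes>\<^sub>M borel)) (\<lambda>\<omega>. (X \<omega>, (G \<omega>, N0 \<omega>))) = ?\<mu> \<Otimes>\<^sub>M (?\<gamma> \<Otimes>\<^sub>M ?n)"
    using X_GN G_N unfolding n by simp
  let ?h = "\<lambda>x y z. h (x, (y / sqrt z, z))"
  let ?F = "\<lambda>(x, (g, y)). ?h x (sqrt (s * x) + y) (g + (sqrt (s * x) + y)\<^sup>2)"
  have "(\<integral>\<^sup>+\<omega>. h (X \<omega>, (channel_ratio lam X G N s \<omega>, channel_output lam X G N s \<omega>)) \<partial>M) =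
      (\<integral>\<^sup>+\<omega>. ?F (X \<omega>, (G \<omega>, N0 \<omega>)) \<partial>M)"
    by (simp add: channel_ratio_def channel_output_def channel_Y_def N0_def)
  also have "\<dots> = (\<integral>\<^sup>+p. ?F p \<partial>distr M (borel \<Otimes>\<^sub>M (borel \<Otimes>\<^sub>M borel)) (\<lambda>\<omega>. (X \<omega>, (G \<omega>, N0 \<omega>))))"
    by (rule nn_integral_distr[symmetric]) measurable
  also have "\<dots> = (\<integral>\<^sup>+x. \<integral>\<^sup>+p. ?F (x, p) \<partial>(?\<gamma> \<Otimes>\<^sub>M ?n) \<partial>?\<mu>)"
    unfolding joint by (rule \<gamma>n.nn_integral_fst[symmetric]) measurable
  also have "\<dots> = (\<integral>\<^sup>+x. \<integral>\<^sup>+z. \<integral>\<^sup>+v. h (x, (v, z)) * ennreal (exp (tilt_exponent lam s (sqrt z) x v)) \<partial>\<pi> \<partial>\<nu> \<partial>?\<mu>)"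
  proof (rule nn_integral_cong_AE)
    have "AE x in ?\<mu>. 0 < x" using X_pos by (subst AE_distr_iff) auto
    then show "AE x in ?\<mu>. (\<integral>\<^sup>+p. ?F (x, p) \<partial>(?\<gamma> \<Otimes>\<^sub>M ?n)) =
        (\<integral>\<^sup>+z. \<integral>\<^sup>+v. h (x, (v, z)) * ennreal (exp (tilt_exponent lam s (sqrt z) x v)) \<partial>\<pi> \<partial>\<nu>)"
    proof eventually_elim
      case (elim x)
      let ?a = "sqrt (s * x)"
      let ?e = "\<lambda>y. ennreal (exp (lam * (2 * ?a * y - s * x)))"
      have a2: "?a\<^sup>2 = s * x" using elim s by simp
      have \<phi>: "ennreal (?\<phi> (y - ?a)) = ?e y * ennreal (?\<phi> y)" for y
      proof -
        have "- lam * (y - ?a)\<^sup>2 = lam * (2 * ?a * y - s * x) + - lam * y\<^sup>2"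
          unfolding power2_diff a2 by (simp add: algebra_simps)
        then have "exp (- lam * (y - ?a)\<^sup>2) = exp (lam * (2 * ?a * y - s * x)) * exp (- lam * y\<^sup>2)"
          by (simp only: exp_add)
        then have "?\<phi> (y - ?a) = exp (lam * (2 * ?a * y - s * x)) * ?\<phi> y"
          unfolding normal_density_lam[OF lam] by simp
        then show ?thesis by (simp only: ennreal_mult' exp_ge_zero)
      qed
      have "(\<integral>\<^sup>+p. ?F (x, p) \<partial>(?\<gamma> \<Otimes>\<^sub>M ?n)) = (\<integral>\<^sup>+g. \<integral>\<^sup>+y. ?h x (?a + y) (g + (?a + y)\<^sup>2) \<partial>?n \<partial>?\<gamma>)"
        by (subst n.nn_integral_fst[symmetric]) simp_all
      also have "\<dots> = (\<integral>\<^sup>+g. \<integral>\<^sup>+y. (?h x y (g + y\<^sup>2) * ?e y) * ennreal (?\<phi> y) \<partial>lborel \<partial>?\<gamma>)"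
      proof (rule nn_integral_cong)
        fix g
        have "(\<integral>\<^sup>+y. ?h x (?a + y) (g + (?a + y)\<^sup>2) \<partial>?n) = (\<integral>\<^sup>+y. ennreal (?\<phi> y) * ?h x (?a + y) (g + (?a + y)\<^sup>2) \<partial>lborel)"
          by (rule nn_integral_density) measurable
        also have "\<dots> = (\<integral>\<^sup>+y. ennreal (?\<phi> (y - ?a)) * ?h x y (g + y\<^sup>2) \<partial>lborel)"
          by (subst nn_integral_real_affine[where c=1 and t="- ?a"]) auto
        finally show "(\<integral>\<^sup>+y. ?h x (?a + y) (g + (?a + y)\<^sup>2) \<partial>?n) = (\<integral>\<^sup>+y. (?h x y (g + y\<^sup>2) * ?e y) * ennreal (?\<phi> y) \<partial>lborel)"
          unfolding \<phi> by (simp add: mult_ac)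
      qed
      also have "\<dots> = (\<integral>\<^sup>+z. \<integral>\<^sup>+v. ?h x (v * sqrt z) z * ?e (v * sqrt z) \<partial>\<pi> \<partial>\<nu>)"
        using polar[of "\<lambda>(y, z). ?h x y z * ?e y"] by simp
      also have "\<dots> = (\<integral>\<^sup>+z. \<integral>\<^sup>+v. h (x, (v, z)) * ennreal (exp (tilt_exponent lam s (sqrt z) x v)) \<partial>\<pi> \<partial>\<nu>)"
      proof (rule nn_integral_cong_AE)
        show "AE z in \<nu>. (\<integral>\<^sup>+v. ?h x (v * sqrt z) z * ?e (v * sqrt z) \<partial>\<pi>) =
            (\<integral>\<^sup>+v. h (x, (v, z)) * ennreal (exp (tilt_exponent lam s (sqrt z) x v)) \<partial>\<pi>)"
          using \<nu>(3) by eventually_elim (simp add: tilt_exponent_def mult.assoc)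
      qed
      finally show ?case .
    qed
  qed
  also have "\<dots> = (\<integral>\<^sup>+z. \<integral>\<^sup>+x. \<integral>\<^sup>+v. h (x, (v, z)) * ennreal (exp (tilt_exponent lam s (sqrt z) x v)) \<partial>\<pi> \<partial>?\<mu> \<partial>\<nu>)"
    by (rule \<mu>\<nu>.Fubini'[symmetric]) (simp add: tilt_exponent_def)
  finally show ?thesis .
qed

section \<open>The derivative bound\<close>

theorem mainTheorem3:
  fixes M :: "'a measure" and X G N :: "'a \<Rightarrow> real" and \<alpha> lam r :: real
  assumes "prob_space M"
    and "\<alpha> \<ge> 1/2" and "lam > 0"
    and "prob_space.indep_vars M (\<lambda>_. borel) (\<lambda>i. [X, G, N] ! i) {0, 1, 2}"
    and "AE \<omega> in M. X \<omega> > 0"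
    and "integrable M (\<lambda>\<omega>. X \<omega> powr (\<alpha> + 4))"
    and "distr M borel G = gamma_distribution (\<alpha> - 1/2) lam"
    and "distributed M lborel N std_normal_density"
    and "r > 0"
  defines "I \<equiv> \<lambda>s. prob_space.mutual_information M (exp 1) borel borel X (channel_output lam X G N s)"
    and "F \<equiv> vimage_algebra (space M) (channel_output lam X G N r) borel"
  shows "I differentiable (at r) \<and>
    deriv I r \<le> lam *
      ((LINT \<omega>|M. X \<omega>) -
       (LINT \<omega>|M. (real_cond_exp M F (\<lambda>\<omega>'. sqrt (X \<omega>') * channel_ratio lam X G N r \<omega>') \<omega>)\<^sup>2))"
proof -
  interpret prob_space M by (rule assms(1))
  have \<alpha>: "0 \<le> \<alpha> - 1/2" using assms(2) by simp
  have rv: "([X, G, N] ! i) \<in> borel_measurable M" if "i \<in> {0, 1, 2 :: nat}" for i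
    using assms(4) that unfolding indep_vars_def by blast
  have [measurable]: "X \<in> borel_measurable M" "G \<in> borel_measurable M" "N \<in> borel_measurable M"
    using rv[of 0] rv[of 1] rv[of 2] by simp_all
  have "prob_space (gamma_distribution (\<alpha> - 1/2) lam)"
    unfolding assms(7)[symmetric] by (rule prob_space_distr) simp
  then obtain \<pi> \<nu> :: "real measure" where
      \<pi>: "prob_space \<pi>" "sets \<pi> = sets borel" "AE v in \<pi>. \<bar>v\<bar> \<le> 1" "0 < emeasure \<pi> {0..}"
    and \<nu>: "prob_space \<nu>" "sets \<nu> = sets borel" "AE z in \<nu>. 0 < z"
    and polar: "\<And>h. h \<in> borel_measurable (borel \<Otimes>\<^sub>M borel) \<Longrightarrow>
      (\<integral>\<^sup>+g. \<integral>\<^sup>+y. h (y, g + y\<^sup>2) * ennreal (normal_density 0 (1 / sqrt (2 * lam)) y) \<partial>lborel \<partial>distr M borel G) =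
      (\<integral>\<^sup>+z. \<integral>\<^sup>+v. h (v * sqrt z, z) \<partial>\<pi> \<partial>\<nu>)"
    using polar_decomposition[OF \<alpha> assms(3)] unfolding assms(7) by blast
  have "AE g in distr M borel G. 0 \<le> g"
    unfolding assms(7) by (rule gamma_distribution_moment[OF \<alpha> assms(3)])
  then have G_nonneg: "AE \<omega> in M. 0 \<le> G \<omega>"
    by (subst (asm) AE_distr_iff) auto
  have "integrable (distr M borel G) (\<lambda>g. g)"
    unfolding assms(7) by (rule gamma_distribution_moment[OF \<alpha> assms(3)])
  then have G_int: "integrable M G"
    by (subst (asm) integrable_distr_eq) auto
  have N_int: "integrable M (\<lambda>\<omega>. (N \<omega>)\<^sup>2)"
    using distributed_integrable[OF assms(8), of "\<lambda>x. x\<^sup>2"] integrable_std_normal_moment[of 2]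
    by (simp add: normal_density_nonneg)
  have X_int: "integrable M X"
  proof (rule Bochner_Integration.integrable_bound)
    show "integrable M (\<lambda>\<omega>. 1 + X \<omega> powr (\<alpha> + 4))" using assms(6) by simp
    show "AE \<omega> in M. norm (X \<omega>) \<le> norm (1 + X \<omega> powr (\<alpha> + 4))"
      using assms(5)
    proof eventually_elim
      case (elim \<omega>)
      have "X \<omega> \<le> 1 + X \<omega> powr (\<alpha> + 4)"
      proof (cases "X \<omega> \<le> 1")
        case False
        then have "X \<omega> powr 1 \<le> X \<omega> powr (\<alpha> + 4)" using assms(2) by (intro powr_mono) auto
        then show ?thesis using elim by simp
      qed (simp add: add_increasing2)
      then show ?case using elim by simp
    qed
  qed simp
  interpret C: polar_channel M X G N lam \<pi> \<nu>
  proof (intro polar_channel.intro polar_channel_axioms.intro)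
    fix s :: real and h :: "real \<times> real \<times> real \<Rightarrow> ennreal"
    assume "0 < s" "h \<in> borel_measurable (borel \<Otimes>\<^sub>M (borel \<Otimes>\<^sub>M borel))"
    then show "(\<integral>\<^sup>+\<omega>. h (X \<omega>, (channel_ratio lam X G N s \<omega>, channel_output lam X G N s \<omega>)) \<partial>M) =
        (\<integral>\<^sup>+z. \<integral>\<^sup>+x. \<integral>\<^sup>+v. h (x, (v, z)) * ennreal (exp (tilt_exponent lam s (sqrt z) x v)) \<partial>\<pi> \<partial>distr M borel X \<partial>\<nu>)"
      by (intro channel_joint_law[OF assms(3) _ assms(4,5,8) \<pi>(1,2) \<nu> polar])
  qed (fact assms(1,3,5) G_nonneg X_int G_int N_int \<pi> \<nu> \<open>X \<in> borel_measurable M\<close>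
      \<open>G \<in> borel_measurable M\<close> \<open>N \<in> borel_measurable M\<close>)+
  have "(I has_real_derivative expectation (C.info_deriv r)) (at r)"
    unfolding I_def using C.has_derivative_mutual_information[OF assms(9)] .
  then have "I differentiable (at r)" "deriv I r = expectation (C.info_deriv r)"
    by (auto simp: real_differentiable_def intro: DERIV_imp_deriv)
  then show ?thesis
    using C.info_deriv_le[OF assms(9)] unfolding F_def by simp
qed

end
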